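(* Let $W=W_{B_n}$ and let $M$ be a $K$-module. The action of $y_i$ on the $\ddot{\mathfrak H}^{\mathfrak c}_W$-module $\mathbb C[x_1,\dots,x_n]\otimes M$ is realized as follows. For any polynomial $f\in\mathbb C[x_1,\dots,x_n]$ and $m\in M$, $$\begin{aligned} y_i\circ(f\otimes m)=&-u\sum_{k\ne i}\left(\frac{f-f^{s_{ki}}}{x_i-x_k}+\frac{f-f^{\overline{s}_{ki}}}{x_i+x_k}c_kc_i\right)\otimes s_{ki}m\\ &-u\sum_{k\ne i}\left(\frac{f-f^{\overline{s}_{ki}}}{x_i+x_k}-\frac{f-f^{s_{ki}}}{x_i-x_k}c_kc_i\right)\otimes\overline{s}_{ki}m-\sqrt2\,v\,\frac{f-f^{\tau_i}}{2x_i}\otimes\tau_im .\end{aligned}$$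
   Context: Ground field $\mathbb C$, $u,v\in\mathbb C$. $W=W_{B_n}$ ($n\ge2$) is the group of signed permutations of $e_1,\dots,e_n$. For $i\ne j$: $s_{ij}$ swaps $e_i,e_j$; $\overline{s}_{ij}$ sends $e_i\mapsto-e_j$, $e_j\mapsto-e_i$; $\tau_i$ sends $e_i\mapsto-e_i$ (other basis vectors fixed). $\mathcal C_n$ is generated by $c_1,\dots,c_n$ with $c_i^2=1$, $c_ic_j=-c_jc_i$ ($i\ne j$); $W$ acts on the $c_i$ (by algebra automorphisms), on $\mathfrak h^*=\bigoplus\mathbb Cx_i$ and on $\mathfrak h=\bigoplus\mathbb Cy_i$ by the same signed permutations as on the $e_i$. $K=\mathcal C_n\rtimes\mathbb CW$. The rational double affine Hecke-Clifford algebra $\ddot{\mathfrak H}^{\mathfrak c}_W$ of type $B_n$ is generated by $x_i,y_i,c_i$ ($1\le i\le n$) and $W$, subject to the relations of $K$ and: $x_ix_j=x_jx_i$, $y_iy_j=y_jy_i$, $y_ic_j=c_jy_i$ (all $i,j$); $x_ic_i=-c_ix_i$, $x_ic_j=c_jx_i$ ($i\ne j$); $wxw^{-1}=w(x)$, $wyw^{-1}=w(y)$ ($w\in W$, $x\in\mathfrak h^*$, $y\in\mathfrak h$); $[y_j,x_i]=u\big((1+c_jc_i)s_{ij}-(1-c_jc_i)\overline{s}_{ij}\big)$ ($i\ne j$); $[y_i,x_i]=-u\sum_{k\ne i}\big((1+c_kc_i)s_{ki}+(1-c_kc_i)\overline{s}_{ki}\big)-\sqrt2\,v\tau_i$. It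 has the triangular decomposition $\mathbb C[x_1,\dots,x_n]\otimes K\otimes\mathbb C[y_1,\dots,y_n]$. Let $\mathfrak H_y$ be the subalgebra generated by $K$ and $y_1,\dots,y_n$. A $K$-module $M$ is extended to an $\mathfrak H_y$-module by letting all $y_i$ act by $0$, and $M_y=\mathrm{Ind}_{\mathfrak H_y}^{\ddot{\mathfrak H}^{\mathfrak c}_W}M$ is identified as a vector space with $\mathbb C[x_1,\dots,x_n]\otimes M$; this is the module structure in question ($\circ$ denotes the action; $x_i$ acts by left multiplication). $f^\sigma$ denotes the action of $\sigma\in W$ on a polynomial $f$. An expression $(p\,a)\otimes m$ with $p\in\mathbb C[x_1,\dots,x_n]$, $a\in\mathcal C_n$ means $p\otimes am$. *)

theory Defs
  imports
    Complex_Main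
    "HOL-Algebra.Algebra"
    "HOL-Algebra.Free_Abelian_Groups"
    "HOL-Library.Poly_Mapping"
    "HOL-Library.Cardinality"
    "HOL-Combinatorics.Transposition"
begin

section \<open>Signed permutations and polynomials\<close>

text \<open>The pair \<open>(p, e)\<close> stands for the signed permutation \<open>e\<^sub>i \<mapsto> e i \<cdot> e\<^bsub>p i\<^esub>\<close>.
  The index set \<open>{1, \<dots>, n}\<close> is a finite linearly ordered type \<open>'n\<close>; the order is used only
  to write a monomial as a word.\<close>

type_synonym 'n sperm = "('n \<Rightarrow> 'n) \<times> ('n \<Rightarrow> int)"

definition B_group :: "'n sperm monoid" where
  "B_group =
    \<lparr>carrier = {(p, e). bij p \<and> (\<forall>i. e i \<in> {1, -1})},
     monoid.mult = (\<lambda>(p, e) (p', e'). (p \<circ> p', \<lambda>i. e' i * e (p' i))),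
     one = (id, \<lambda>_. 1)\<rparr>"

definition s_refl :: "'n \<Rightarrow> 'n \<Rightarrow> 'n sperm" where
  "s_refl i j = (Transposition.transpose i j, \<lambda>_. 1)"

definition sbar_refl :: "'n \<Rightarrow> 'n \<Rightarrow> 'n sperm" where
  "sbar_refl i j = (Transposition.transpose i j, \<lambda>l. if l = i \<or> l = j then -1 else 1)"

definition tau_refl :: "'n \<Rightarrow> 'n sperm" where
  "tau_refl i = (id, \<lambda>l. if l = i then -1 else 1)"

definition signed_act :: "'n sperm \<Rightarrow> ('n \<Rightarrow> 'a::ring_1) \<Rightarrow> 'n \<Rightarrow> 'a" where
  "signed_act w g i = of_int (snd w i) * g (fst w i)"

type_synonym 'n cpoly = "('n \<Rightarrow>\<^sub>0 nat) \<Rightarrow>\<^sub>0 complex"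

definition pvar :: "'n \<Rightarrow> 'n cpoly" where
  "pvar i = Poly_Mapping.single (Poly_Mapping.single i 1) 1"

definition poly_act :: "'n::finite sperm \<Rightarrow> 'n cpoly \<Rightarrow> 'n cpoly" where
  "poly_act w f =
    (\<Sum>a\<in>Poly_Mapping.keys f. Poly_Mapping.single 0 (Poly_Mapping.lookup f a) *
      (\<Prod>i\<in>UNIV. signed_act w pvar i ^ Poly_Mapping.lookup a i))"

text \<open>The exact quotient \<open>f / g\<close>; it is unique for \<open>g \<noteq> 0\<close> since polynomials form a domain.\<close>

definition pquot :: "'n cpoly \<Rightarrow> 'n cpoly \<Rightarrow> 'n cpoly" where
  "pquot f g = (THE q. f = g * q)"


section \<open>Algebras by generators and relations\<close>

text \<open>The free complex algebra consists of the finitely supported functions on the free monoid,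
  with convolution product.\<close>

datatype 'g fmon = FMon (letters: "'g list")

instantiation fmon :: (type) monoid_add
begin
definition zero_fmon :: "'a fmon" where "zero_fmon = FMon []"
definition plus_fmon :: "'a fmon \<Rightarrow> 'a fmon \<Rightarrow> 'a fmon"
  where "plus_fmon a b = FMon (letters a @ letters b)"
instance by standard (simp_all add: zero_fmon_def plus_fmon_def)
end

type_synonym 'g falg = "'g fmon \<Rightarrow>\<^sub>0 complex"

definition fgen :: "'g \<Rightarrow> 'g falg" where
  "fgen g = Poly_Mapping.single (FMon [g]) 1"

definition fscal :: "complex \<Rightarrow> 'g falg" where
  "fscal z = Poly_Mapping.single 0 z"

definition free_alg :: "'g set \<Rightarrow> 'g falg ring" where
  "free_alg G =
    \<lparr>carrier = {a. \<forall>w\<in>Poly_Mapping.keys a. set (letters w) \<subseteq> G},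
     monoid.mult = (*), one = 1, ring.zero = 0, add = (+)\<rparr>"

definition pres_alg :: "'g set \<Rightarrow> 'g falg set \<Rightarrow> 'g falg set ring" where
  "pres_alg G R = free_alg G Quot (Idl\<^bsub>free_alg G\<^esub> R)"

definition pres_cls :: "'g set \<Rightarrow> 'g falg set \<Rightarrow> 'g falg \<Rightarrow> 'g falg set" where
  "pres_cls G R a = (Idl\<^bsub>free_alg G\<^esub> R) +>\<^bsub>free_alg G\<^esub> a"


section \<open>The algebra \<open>K\<close> and the double affine Hecke-Clifford algebra\<close>

datatype 'n gen = GX 'n | GY 'n | GC 'n | GW "'n sperm"

abbreviation xg :: "'n \<Rightarrow> 'n gen falg" where "xg i \<equiv> fgen (GX i)"
abbreviation yg :: "'n \<Rightarrow> 'n gen falg" where "yg i \<equiv> fgen (GY i)"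
abbreviation cg :: "'n \<Rightarrow> 'n gen falg" where "cg i \<equiv> fgen (GC i)"
abbreviation wg :: "'n sperm \<Rightarrow> 'n gen falg" where "wg w \<equiv> fgen (GW w)"

definition K_gens :: "'n gen set" where
  "K_gens = range GC \<union> GW ` carrier B_group"

definition H_gens :: "'n gen set" where
  "H_gens = K_gens \<union> range GX \<union> range GY"

text \<open>An element \<open>a\<close> of a relation set stands for the relation \<open>a = 0\<close>.\<close>

definition K_rels :: "'n gen falg set" where
  "K_rels =
     {cg i * cg i - 1 | i. True}
   \<union> {cg i * cg j + cg j * cg i | i j. i \<noteq> j}
   \<union> {wg \<one>\<^bsub>B_group\<^esub> - 1}
   \<union> {wg w * wg w' - wg (w \<otimes>\<^bsub>B_group\<^esub> w') | w w'. w \<in> carrier B_group \<and> w' \<in> carrier B_group}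
   \<union> {wg w * cg i * wg (inv\<^bsub>B_group\<^esub> w) - signed_act w cg i | w i. w \<in> carrier B_group}"

definition commutator :: "'a::ring \<Rightarrow> 'a \<Rightarrow> 'a" where
  "commutator a b = a * b - b * a"

definition H_rels :: "complex \<Rightarrow> complex \<Rightarrow> 'n::finite gen falg set" where
  "H_rels u v = K_rels
   \<union> {commutator (xg i) (xg j) | i j. True}
   \<union> {commutator (yg i) (yg j) | i j. True}
   \<union> {commutator (yg i) (cg j) | i j. True}
   \<union> {xg i * cg i + cg i * xg i | i. True}
   \<union> {commutator (xg i) (cg j) | i j. i \<noteq> j}
   \<union> {wg w * xg i * wg (inv\<^bsub>B_group\<^esub> w) - signed_act w xg i | w i. w \<in> carrier B_group}
   \<union> {wg w * yg i * wg (inv\<^bsub>B_group\<^esub> w) - signed_act w yg i | w i. w \<in> carrier B_group}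
   \<union> {commutator (yg j) (xg i)
        - fscal u * ((1 + cg j * cg i) * wg (s_refl i j) - (1 - cg j * cg i) * wg (sbar_refl i j))
      | i j. i \<noteq> j}
   \<union> {commutator (yg i) (xg i)
        - (- fscal u * (\<Sum>k\<in>UNIV - {i}. (1 + cg k * cg i) * wg (s_refl k i)
                                        + (1 - cg k * cg i) * wg (sbar_refl k i))
           - fscal (of_real (sqrt 2) * v) * wg (tau_refl i))
      | i. True}"

definition K_alg :: "'n gen falg set ring" where
  "K_alg = pres_alg K_gens K_rels"

definition K_cls :: "'n gen falg \<Rightarrow> 'n gen falg set" where
  "K_cls = pres_cls K_gens K_rels"

definition H_alg :: "complex \<Rightarrow> complex \<Rightarrow> 'n::finite gen falg set ring" where
  "H_alg u v = pres_alg H_gens (H_rels u v)"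

definition H_cls :: "complex \<Rightarrow> complex \<Rightarrow> 'n::finite gen falg \<Rightarrow> 'n gen falg set" where
  "H_cls u v = pres_cls H_gens (H_rels u v)"

definition Hy_alg :: "complex \<Rightarrow> complex \<Rightarrow> 'n::finite gen falg set ring" where
  "Hy_alg u v = (H_alg u v)\<lparr>carrier := generate_ring (H_alg u v)
      (H_cls u v ` carrier (free_alg K_gens) \<union> range (\<lambda>i. H_cls u v (yg i)))\<rparr>"


section \<open>Modules and induction\<close>

text \<open>Unital left modules on a whole type. A module over one of the algebras above is a complex
  vector space through the classes of the scalars \<open>fscal z\<close>.\<close>

definition left_module :: "('a, 'b) ring_scheme \<Rightarrow> ('a \<Rightarrow> 'm::ab_group_add \<Rightarrow> 'm) \<Rightarrow> bool" where
  "left_module R \<rho> \<longleftrightarrow>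
     (\<forall>m. \<rho> \<one>\<^bsub>R\<^esub> m = m) \<and>
     (\<forall>a\<in>carrier R. \<forall>m m'. \<rho> a (m + m') = \<rho> a m + \<rho> a m') \<and>
     (\<forall>a\<in>carrier R. \<forall>b\<in>carrier R. \<forall>m.
        \<rho> (a \<oplus>\<^bsub>R\<^esub> b) m = \<rho> a m + \<rho> b m \<and> \<rho> (a \<otimes>\<^bsub>R\<^esub> b) m = \<rho> a (\<rho> b m))"

text \<open>The extension of a \<open>K\<close>-module to the subalgebra generated by \<open>K\<close> and the \<open>y\<^sub>i\<close>, with all
  \<open>y\<^sub>i\<close> acting by zero. It exists by the triangular decomposition, and it is unique because the
  action is prescribed on generators.\<close>

definition extend_zero ::
  "complex \<Rightarrow> complex \<Rightarrow> ('n::finite gen falg set \<Rightarrow> 'm::ab_group_add \<Rightarrow> 'm)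
     \<Rightarrow> 'n gen falg set \<Rightarrow> 'm \<Rightarrow> 'm" where
  "extend_zero u v \<rho> = (THE \<rho>'.
     left_module (Hy_alg u v) \<rho>' \<and>
     (\<forall>a\<in>carrier (free_alg K_gens). \<rho>' (H_cls u v a) = \<rho> (K_cls a)) \<and>
     (\<forall>i. \<rho>' (H_cls u v (yg i)) = (\<lambda>_. 0)) \<and>
     (\<forall>h. h \<notin> carrier (Hy_alg u v) \<longrightarrow> \<rho>' h = undefined))"

text \<open>For a subring \<open>S\<close> of \<open>R\<close> and a left \<open>S\<close>-module, the tensor product of \<open>R\<close> with the module over
  \<open>S\<close> is the free abelian group on pairs modulo the subgroup \<open>tensor_ker\<close>. Its elements are
  cosets, and the class of \<open>frag_of (a, m)\<close> is the pure tensor of \<open>a\<close> and \<open>m\<close>.\<close>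

definition pairs_group :: "('a, 'b) ring_scheme \<Rightarrow> ('a \<times> 'm \<Rightarrow>\<^sub>0 int) monoid" where
  "pairs_group R = free_Abelian_group (carrier R \<times> UNIV)"

definition tensor_ker ::
  "('a, 'b) ring_scheme \<Rightarrow> ('a, 'c) ring_scheme \<Rightarrow> ('a \<Rightarrow> 'm::ab_group_add \<Rightarrow> 'm)
     \<Rightarrow> ('a \<times> 'm \<Rightarrow>\<^sub>0 int) set" where
  "tensor_ker R S \<rho> = generate (pairs_group R)
     ({frag_of (a \<oplus>\<^bsub>R\<^esub> b, m) - frag_of (a, m) - frag_of (b, m) | a b m.
         a \<in> carrier R \<and> b \<in> carrier R}
    \<union> {frag_of (a, m + m') - frag_of (a, m) - frag_of (a, m') | a m m'. a \<in> carrier R}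
    \<union> {frag_of (a \<otimes>\<^bsub>R\<^esub> s, m) - frag_of (a, \<rho> s m) | a s m. a \<in> carrier R \<and> s \<in> carrier S})"

definition tensor_cls ::
  "('a, 'b) ring_scheme \<Rightarrow> ('a, 'c) ring_scheme \<Rightarrow> ('a \<Rightarrow> 'm::ab_group_add \<Rightarrow> 'm)
     \<Rightarrow> ('a \<times> 'm \<Rightarrow>\<^sub>0 int) \<Rightarrow> ('a \<times> 'm \<Rightarrow>\<^sub>0 int) set" where
  "tensor_cls R S \<rho> z = tensor_ker R S \<rho> #>\<^bsub>pairs_group R\<^esub> z"

definition tensor_act ::
  "('a, 'b) ring_scheme \<Rightarrow> ('a, 'c) ring_scheme \<Rightarrow> ('a \<Rightarrow> 'm::ab_group_add \<Rightarrow> 'm)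
     \<Rightarrow> 'a \<Rightarrow> ('a \<times> 'm \<Rightarrow>\<^sub>0 int) set \<Rightarrow> ('a \<times> 'm \<Rightarrow>\<^sub>0 int) set" where
  "tensor_act R S \<rho> h Z =
     the_elem ((\<lambda>z. tensor_cls R S \<rho> (frag_extend (\<lambda>(a, m). frag_of (h \<otimes>\<^bsub>R\<^esub> a, m)) z)) ` Z)"


section \<open>The induced module on \<open>\<complex>[x\<^sub>1, \<dots>, x\<^sub>n] \<otimes> M\<close>\<close>

text \<open>The tensor product over \<open>\<complex>\<close> of the polynomial ring with \<open>M\<close> is modelled by the polynomials with
  coefficients in \<open>M\<close>, that is \<open>('n \<Rightarrow>\<^sub>0 nat) \<Rightarrow>\<^sub>0 'm\<close>; the tensor of \<open>x\<^sup>a\<close> and \<open>m\<close> has coefficient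
  \<open>m\<close> at \<open>a\<close>.\<close>

definition ptensor ::
  "('n gen falg set \<Rightarrow> 'm::ab_group_add \<Rightarrow> 'm) \<Rightarrow> 'n cpoly \<Rightarrow> 'm \<Rightarrow> ('n \<Rightarrow>\<^sub>0 nat) \<Rightarrow>\<^sub>0 'm" where
  "ptensor \<rho> f m = Poly_Mapping.map (\<lambda>z. \<rho> (K_cls (fscal z)) m) f"

definition pscale ::
  "('n gen falg set \<Rightarrow> 'm::ab_group_add \<Rightarrow> 'm) \<Rightarrow> complex
     \<Rightarrow> (('n \<Rightarrow>\<^sub>0 nat) \<Rightarrow>\<^sub>0 'm) \<Rightarrow> ('n \<Rightarrow>\<^sub>0 nat) \<Rightarrow>\<^sub>0 'm" where
  "pscale \<rho> z = Poly_Mapping.map (\<rho> (K_cls (fscal z)))"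

definition xmon :: "('n::{finite,linorder} \<Rightarrow>\<^sub>0 nat) \<Rightarrow> 'n gen falg" where
  "xmon a = prod_list (map (\<lambda>i. xg i ^ Poly_Mapping.lookup a i) (sorted_list_of_set UNIV))"

text \<open>The identification of \<open>\<complex>[x\<^sub>1, \<dots>, x\<^sub>n] \<otimes> M\<close> with the induced module: the tensor of \<open>f\<close> and \<open>m\<close>
  is sent to the pure tensor of \<open>f\<close>, read in the double affine Hecke-Clifford algebra, and \<open>m\<close>.
  It is bijective by the triangular decomposition.\<close>

definition ind_ident ::
  "complex \<Rightarrow> complex \<Rightarrow> ('n::{finite,linorder} gen falg set \<Rightarrow> 'm::ab_group_add \<Rightarrow> 'm)
     \<Rightarrow> (('n \<Rightarrow>\<^sub>0 nat) \<Rightarrow>\<^sub>0 'm) \<Rightarrow> ('n gen falg set \<times> 'm \<Rightarrow>\<^sub>0 int) set" where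
  "ind_ident u v \<rho> t = tensor_cls (H_alg u v) (Hy_alg u v) (extend_zero u v \<rho>)
     (\<Sum>a\<in>Poly_Mapping.keys t. frag_of (H_cls u v (xmon a), Poly_Mapping.lookup t a))"

definition ind_act ::
  "complex \<Rightarrow> complex \<Rightarrow> ('n::{finite,linorder} gen falg set \<Rightarrow> 'm::ab_group_add \<Rightarrow> 'm)
     \<Rightarrow> 'n gen falg set \<Rightarrow> (('n \<Rightarrow>\<^sub>0 nat) \<Rightarrow>\<^sub>0 'm) \<Rightarrow> (('n \<Rightarrow>\<^sub>0 nat) \<Rightarrow>\<^sub>0 'm)" where
  "ind_act u v \<rho> h t = inv_into UNIV (ind_ident u v \<rho>)
     (tensor_act (H_alg u v) (Hy_alg u v) (extend_zero u v \<rho>) h (ind_ident u v \<rho> t))"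

end

theory Submission
  imports Defs
begin

text \<open>The formula defines operators on polynomials with coefficients in \<open>M\<close>, and the point is that
  they make this space a module over the whole algebra. All operators are sums
  of operators \<open>T \<otimes> L\<close>: \<open>x\<^sub>j\<close> acts by \<open>x\<^sub>j \<otimes> 1\<close>, \<open>c\<^sub>j\<close> by \<open>\<tau>\<^sub>j \<otimes> c\<^sub>j\<close>, \<open>w\<close> by \<open>w \<otimes> w\<close>, and \<open>y\<^sub>i\<close> by
  divided differences tensored with elements of \<open>K\<close>. The twisted Leibniz rule for divided differences gives the commutators of
  \<open>y\<^sub>i\<close> and \<open>x\<^sub>j\<close>; the remaining relations, in particular the commutativity of the \<open>y\<^sub>i\<close>, follow
  because an operator that kills the constants and commutes with the \<open>x\<^sub>k\<close> up to a left factor is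
  zero. The constants form a copy of \<open>M\<close> on which \<open>y\<^sub>i\<close> acts by zero. This yields the
  extension of \<open>M\<close> and a left inverse of the identification with the induced module. Hence
  that identification is injective, and it remains to see that it intertwines the actions of the
  generators, which is an induction on monomials.\<close>


section \<open>Additive endomorphisms\<close>

text \<open>The algebra and the induced module are given by presentations, and relations alone can
  identify classes but never separate them. Separation comes from a concrete representation, and
  both the \<open>THE\<close> in \<open>extend_zero\<close> and the \<open>inv_into\<close> in
  \<open>ind_act\<close> depend on it. The operator \<tau>_j \<otimes> c_j for c_j reflects the rule
  c_j f = f^\<tau>_j c_j for a polynomial f. It also explains the crossing in the formula: c_k c_i
  s_ki acts on the polynomial factor through \<tau>_k \<tau>_i s_ki = sbar_ki, so the terms with c_k
  c_i carry the divided difference of the opposite reflection. The obstacle is the commutativity of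
  the y_i. Expanding products of two divided differences is avoided: commuting past one x_k reduces
  the claim to the Jacobi identity for y_i, y_j, x_k, which is an identity between single
  commutators.\<close>

text \<open>The endomorphisms do not form an instance of the class of unital rings \<open>ring_1\<close>, which requires
  \<open>0 \<noteq> 1\<close>: the module may be trivial.\<close>

typedef (overloaded) 'v endo = "{f :: 'v::ab_group_add \<Rightarrow> 'v. \<forall>x y. f (x + y) = f x + f y}"
  morphisms app Endo
  by (rule exI[of _ "\<lambda>x. 0"]) simp

setup_lifting type_definition_endo

instantiation endo :: (ab_group_add) "{ring, monoid_mult}"
begin
lift_definition zero_endo :: "'a endo" is "\<lambda>_. 0" by simp
lift_definition one_endo :: "'a endo" is "\<lambda>x. x" by simp
lift_definition plus_endo :: "'a endo \<Rightarrow> 'a endo \<Rightarrow> 'a endo" is "\<lambda>f g x. f x + g x"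
  by (simp add: algebra_simps)
lift_definition minus_endo :: "'a endo \<Rightarrow> 'a endo \<Rightarrow> 'a endo" is "\<lambda>f g x. f x - g x"
  by (simp add: algebra_simps)
lift_definition uminus_endo :: "'a endo \<Rightarrow> 'a endo" is "\<lambda>f x. - f x"
  by (simp add: algebra_simps)
lift_definition times_endo :: "'a endo \<Rightarrow> 'a endo \<Rightarrow> 'a endo" is "\<lambda>f g x. f (g x)"
  by simp
instance by standard (transfer; simp add: algebra_simps fun_eq_iff)+
end

lemma endo_eqI: "(\<And>x. app f x = app g x) \<Longrightarrow> f = g"
  by transfer auto

lemma app_add [simp]: "app f (x + y) = app f x + app f y"
  by transfer auto

lemma app_zero [simp]: "app f 0 = 0"
  using app_add[of f 0 0] by (simp del: app_add)

lemma app_minus [simp]: "app f (- x) = - app f x"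
  using app_add[of f x "- x"] by (simp del: app_add add: eq_neg_iff_add_eq_0 add.commute)

lemma endo_apps [simp]:
  "app 0 x = 0" "app 1 x = x" "app (f + g) x = app f x + app g x"
  "app (f - g) x = app f x - app g x" "app (- f) x = - app f x"
  "app (f * g) x = app f (app g x)"
  by (transfer; simp)+

lemma app_sum_endo: "app (sum g A) x = (\<Sum>a\<in>A. app (g a) x)"
  by (induction A rule: infinite_finite_induct) auto

lemma app_Endo: "(\<And>x y. f (x + y) = f x + f y) \<Longrightarrow> app (Endo f) = f"
  by (rule Endo_inverse) auto

section \<open>Additive maps on finitely supported functions\<close>

lemma update_eq_add_single:
  fixes f :: "'a \<Rightarrow>\<^sub>0 'b::monoid_add"
  assumes "a \<notin> Poly_Mapping.keys f"
  shows "Poly_Mapping.update a b f = f + Poly_Mapping.single a b"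
  using assms by (intro poly_mapping_eqI)
    (auto simp: lookup_update lookup_add lookup_single not_in_keys_iff_lookup_eq_zero when_def)

text \<open>A finitely supported function is a finite sum of its single-point parts. Letting
  \<open>m\<close> be arbitrary stands in for linearity in the coefficients.\<close>

lemma additive_poly_mapping_eqI:
  fixes h h' :: "('a \<Rightarrow>\<^sub>0 'm::ab_group_add) \<Rightarrow> 'b::ab_group_add"
  assumes "\<And>x y. h (x + y) = h x + h y" "\<And>x y. h' (x + y) = h' x + h' y"
    and s: "\<And>a m. h (Poly_Mapping.single a m) = h' (Poly_Mapping.single a m)"
  shows "h t = h' t"
proof (induction t rule: update_induct)
  case const
  show ?case using s[of undefined 0] by simp
next
  case (update f a b)
  have "Poly_Mapping.update a b f = f + Poly_Mapping.single a b"
    using update by (simp add: update_eq_add_single add.commute)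
  then show ?case using assms update by simp
qed

lemma endo_poly_mapping_eqI:
  fixes f g :: "('a \<Rightarrow>\<^sub>0 'm::ab_group_add) endo"
  assumes "\<And>a m. app f (Poly_Mapping.single a m) = app g (Poly_Mapping.single a m)"
  shows "f = g"
  by (rule endo_eqI, rule additive_poly_mapping_eqI) (auto simp: assms)

lemma sum_keys_superset:
  assumes "finite A" "Poly_Mapping.keys t \<subseteq> A" "\<And>a. h a 0 = (0::'b::comm_monoid_add)"
  shows "(\<Sum>a\<in>Poly_Mapping.keys t. h a (Poly_Mapping.lookup t a))
       = (\<Sum>a\<in>A. h a (Poly_Mapping.lookup t a))"
  by (rule sum.mono_neutral_left) (auto simp: assms in_keys_iff)

text \<open>Cancellation can make the support of \<open>s + t\<close> smaller than the union of the
  two supports. All three sums are therefore taken over the union, where the extra terms vanish by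
  \<open>z\<close>.\<close>

lemma sum_keys_add:
  fixes h :: "'a \<Rightarrow> 'm::ab_group_add \<Rightarrow> 'b::comm_monoid_add"
  assumes z: "\<And>a. h a 0 = 0" and "\<And>a x y. h a (x + y) = h a x + h a y"
  shows "(\<Sum>a\<in>Poly_Mapping.keys (s + t). h a (Poly_Mapping.lookup (s + t) a))
       = (\<Sum>a\<in>Poly_Mapping.keys s. h a (Poly_Mapping.lookup s a))
       + (\<Sum>a\<in>Poly_Mapping.keys t. h a (Poly_Mapping.lookup t a))"
proof -
  let ?A = "Poly_Mapping.keys s \<union> Poly_Mapping.keys t"
  have "(\<Sum>a\<in>Poly_Mapping.keys (s + t). h a (Poly_Mapping.lookup (s + t) a))
      = (\<Sum>a\<in>?A. h a (Poly_Mapping.lookup (s + t) a))"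
    by (rule sum_keys_superset) (auto simp: z Poly_Mapping.keys_add)
  moreover have "(\<Sum>a\<in>Poly_Mapping.keys s. h a (Poly_Mapping.lookup s a))
      = (\<Sum>a\<in>?A. h a (Poly_Mapping.lookup s a))"
    by (rule sum_keys_superset) (auto simp: z)
  moreover have "(\<Sum>a\<in>Poly_Mapping.keys t. h a (Poly_Mapping.lookup t a))
      = (\<Sum>a\<in>?A. h a (Poly_Mapping.lookup t a))"
    by (rule sum_keys_superset) (auto simp: z)
  ultimately show ?thesis
    by (simp add: lookup_add assms sum.distrib)
qed

lemma poly_mapping_sum_single:
  "t = (\<Sum>a\<in>Poly_Mapping.keys t. Poly_Mapping.single a (Poly_Mapping.lookup t a))"
  by (rule poly_mapping_eqI)
     (auto simp: lookup_sum lookup_single when_def in_keys_iff sum.delta)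


section \<open>Free algebras and presentations\<close>

lemma letters_zero [simp]: "letters 0 = []"
  and letters_plus [simp]: "letters (a + b) = letters a @ letters b"
  by (simp_all add: zero_fmon_def plus_fmon_def)

text \<open>The target type carries no complex algebra structure, so the images of the scalars are
  supplied by a separate map \<open>\<sigma>\<close>.\<close>

definition falg_eval ::
  "(complex \<Rightarrow> 'e) \<Rightarrow> ('g \<Rightarrow> 'e) \<Rightarrow> 'g falg \<Rightarrow> 'e::{ring,monoid_mult}" where
  "falg_eval \<sigma> \<theta> a =
    (\<Sum>w\<in>Poly_Mapping.keys a. \<sigma> (Poly_Mapping.lookup a w) * prod_list (map \<theta> (letters w)))"

locale alg_rep =
  fixes \<sigma> :: "complex \<Rightarrow> 'e::{ring,monoid_mult}" and \<theta> :: "'g \<Rightarrow> 'e"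
  assumes scal_add: "\<sigma> (y + z) = \<sigma> y + \<sigma> z"
    and scal_mult: "\<sigma> (y * z) = \<sigma> y * \<sigma> z"
    and scal_one: "\<sigma> 1 = 1"
    and scal_comm: "\<sigma> z * \<theta> g = \<theta> g * \<sigma> z"
begin

abbreviation "ev \<equiv> falg_eval \<sigma> \<theta>"

lemma scal_zero [simp]: "\<sigma> 0 = 0"
  using scal_add[of 0 0] by simp

lemma ev_single: "ev (Poly_Mapping.single w z) = \<sigma> z * prod_list (map \<theta> (letters w))"
  by (cases "z = 0") (simp_all add: falg_eval_def)

lemma ev_zero [simp]: "ev 0 = 0"
  by (simp add: falg_eval_def)

lemma ev_add [simp]: "ev (a + b) = ev a + ev b"
  unfolding falg_eval_def
  by (rule sum_keys_add) (auto simp: scal_add distrib_right)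

lemma ev_minus [simp]: "ev (- a) = - ev a"
  using ev_add[of a "- a"] by (simp del: ev_add add: eq_neg_iff_add_eq_0 add.commute)

lemma ev_diff [simp]: "ev (a - b) = ev a - ev b"
  using ev_add[of a "- b"] by (simp del: ev_add)

lemma ev_sum: "ev (sum g A) = (\<Sum>a\<in>A. ev (g a))"
  by (induction A rule: infinite_finite_induct) auto

lemma scal_comm_list: "\<sigma> z * prod_list (map \<theta> l) = prod_list (map \<theta> l) * \<sigma> z"
proof (induction l)
  case (Cons g l)
  have "\<sigma> z * prod_list (map \<theta> (g # l)) = \<theta> g * (\<sigma> z * prod_list (map \<theta> l))"
    using scal_comm[of z g] by (simp add: mult.assoc[symmetric])
  then show ?case using Cons by (simp add: mult.assoc)
qed simp

text \<open>Both sides are additive in each factor, so two weighted words suffice. Their product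
  concatenates the words, and the second scalar has to cross the first word.\<close>

lemma ev_mult [simp]: "ev (a * b) = ev a * ev b"
proof (rule additive_poly_mapping_eqI[of "\<lambda>a. ev (a * b)" "\<lambda>a. ev a * ev b"])
  fix v y
  show "ev (Poly_Mapping.single v y * b) = ev (Poly_Mapping.single v y) * ev b"
  proof (rule additive_poly_mapping_eqI[of "\<lambda>b. ev (Poly_Mapping.single v y * b)"
        "\<lambda>b. ev (Poly_Mapping.single v y) * ev b"])
    fix w z
    let ?p = "\<lambda>v. prod_list (map \<theta> (letters v))"
    have "ev (Poly_Mapping.single v y * Poly_Mapping.single w z)
        = \<sigma> y * (\<sigma> z * ?p v) * ?p w"
      by (simp add: mult_single ev_single scal_mult mult.assoc)
    also have "\<dots> = \<sigma> y * (?p v * \<sigma> z) * ?p w"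
      by (simp only: scal_comm_list)
    finally show "ev (Poly_Mapping.single v y * Poly_Mapping.single w z)
        = ev (Poly_Mapping.single v y) * ev (Poly_Mapping.single w z)"
      by (simp add: ev_single mult.assoc)
  qed (simp_all add: distrib_left distrib_right)
qed (simp_all add: distrib_left distrib_right)

lemma ev_fscal [simp]: "ev (fscal z) = \<sigma> z"
  by (simp add: fscal_def ev_single)

lemma ev_fgen [simp]: "ev (fgen g) = \<theta> g"
  by (simp add: fgen_def ev_single scal_one)

lemma ev_one [simp]: "ev 1 = 1"
  using ev_fscal[of 1] by (simp add: fscal_def scal_one)

end

abbreviation fcar :: "'g set \<Rightarrow> 'g falg set" where "fcar G \<equiv> carrier (free_alg G)"

lemma free_alg_simps:
  "x \<otimes>\<^bsub>free_alg G\<^esub> y = x * y" "x \<oplus>\<^bsub>free_alg G\<^esub> y = x + y"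
  "\<one>\<^bsub>free_alg G\<^esub> = 1" "\<zero>\<^bsub>free_alg G\<^esub> = 0"
  by (simp_all add: free_alg_def)

lemma fcar_zero [simp]: "0 \<in> fcar G"
  and fcar_one [simp]: "1 \<in> fcar G"
  and fcar_fscal [simp]: "fscal z \<in> fcar G"
  and fcar_fgen [simp]: "fgen g \<in> fcar G \<longleftrightarrow> g \<in> G"
  by (auto simp: free_alg_def fscal_def fgen_def)

lemma fcar_add [simp]: "a \<in> fcar G \<Longrightarrow> b \<in> fcar G \<Longrightarrow> a + b \<in> fcar G"
  using Poly_Mapping.keys_add[of a b] by (auto simp: free_alg_def)

lemma fcar_uminus [simp]: "- a \<in> fcar G \<longleftrightarrow> a \<in> fcar G"
  by (auto simp: free_alg_def in_keys_iff)

lemma fcar_diff [simp]: "a \<in> fcar G \<Longrightarrow> b \<in> fcar G \<Longrightarrow> a - b \<in> fcar G"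
  using fcar_add[of a G "- b"] by simp

lemma fcar_mult [simp]: "a \<in> fcar G \<Longrightarrow> b \<in> fcar G \<Longrightarrow> a * b \<in> fcar G"
  using keys_mult[of a b] by (fastforce simp: free_alg_def)

lemma fcar_sum: "(\<And>i. i \<in> A \<Longrightarrow> f i \<in> fcar G) \<Longrightarrow> sum f A \<in> fcar G"
  by (induction A rule: infinite_finite_induct) auto

lemma fcar_power: "a \<in> fcar G \<Longrightarrow> a ^ n \<in> fcar G"
  by (induction n) auto

lemma fcar_prod_list: "(\<And>x. x \<in> set l \<Longrightarrow> x \<in> fcar G) \<Longrightarrow> prod_list l \<in> fcar G"
  by (induction l) auto

lemma fcar_mono: "G \<subseteq> G' \<Longrightarrow> fcar G \<subseteq> fcar G'"
  by (auto simp: free_alg_def)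

lemma fcar_signed: "snd w i \<in> {1, -1} \<Longrightarrow> g (fst w i) \<in> fcar G \<Longrightarrow> signed_act w g i \<in> fcar G"
  by (auto simp: signed_act_def)

lemma ring_free_alg: "ring (free_alg G)"
proof (rule ringI)
  show "abelian_group (free_alg G)"
  proof (rule abelian_groupI)
    fix x assume "x \<in> fcar G"
    then show "\<exists>y\<in>fcar G. y \<oplus>\<^bsub>free_alg G\<^esub> x = \<zero>\<^bsub>free_alg G\<^esub>"
      by (intro bexI[of _ "- x"]) (auto simp: free_alg_simps)
  qed (auto simp: free_alg_simps add_ac)
  show "monoid (free_alg G)"
    by (rule monoidI) (auto simp: free_alg_simps mult.assoc)
qed (auto simp: free_alg_simps algebra_simps)

lemma a_inv_free_alg: "a \<in> fcar G \<Longrightarrow> \<ominus>\<^bsub>free_alg G\<^esub> a = - a"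
  by (rule abelian_group.minus_equality[OF ring.is_abelian_group[OF ring_free_alg]])
     (auto simp: free_alg_simps)

text \<open>Elements are built as words, then weighted words, then sums over subsets of the support.
  Membership travels along in each claim because the hypotheses for sums and products ask for
  it.\<close>

lemma fcar_induct [consumes 1, case_names scal gen add mult]:
  assumes a: "a \<in> fcar G"
    and s: "\<And>z. P (fscal z)"
    and g: "\<And>g. g \<in> G \<Longrightarrow> P (fgen g)"
    and p: "\<And>a b. a \<in> fcar G \<Longrightarrow> b \<in> fcar G \<Longrightarrow> P a \<Longrightarrow> P b \<Longrightarrow> P (a + b)"
    and m: "\<And>a b. a \<in> fcar G \<Longrightarrow> b \<in> fcar G \<Longrightarrow> P a \<Longrightarrow> P b \<Longrightarrow> P (a * b)"
  shows "P a"
proof -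
  have word: "P (Poly_Mapping.single (FMon l) 1) \<and> Poly_Mapping.single (FMon l) 1 \<in> fcar G"
    if "set l \<subseteq> G" for l
    using that
  proof (induction l)
    case Nil
    show ?case using s[of 1] fcar_fscal[of 1 G] by (simp add: fscal_def zero_fmon_def)
  next
    case (Cons x l)
    have "Poly_Mapping.single (FMon (x # l)) (1::complex) = fgen x * Poly_Mapping.single (FMon l) 1"
      by (simp add: fgen_def mult_single plus_fmon_def)
    then show ?case using Cons m[of "fgen x"] g by simp
  qed
  have term_in: "P (Poly_Mapping.single w z) \<and> Poly_Mapping.single w z \<in> fcar G"
    if "set (letters w) \<subseteq> G" for w z
  proof -
    have "Poly_Mapping.single w z = fscal z * Poly_Mapping.single (FMon (letters w)) 1"
      by (simp add: fscal_def mult_single)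
    then show ?thesis using word[OF that] m[of "fscal z"] s by simp
  qed
  have "P (\<Sum>w\<in>A. Poly_Mapping.single w (Poly_Mapping.lookup a w)) \<and>
      (\<Sum>w\<in>A. Poly_Mapping.single w (Poly_Mapping.lookup a w)) \<in> fcar G"
    if "finite A" "A \<subseteq> Poly_Mapping.keys a" for A
    using that
  proof (induction A rule: finite_induct)
    case empty
    show ?case using s[of 0] by (simp add: fscal_def)
  next
    case (insert w A)
    then have "P (Poly_Mapping.single w (Poly_Mapping.lookup a w)) \<and>
        Poly_Mapping.single w (Poly_Mapping.lookup a w) \<in> fcar G"
      using a by (intro term_in) (auto simp: free_alg_def)
    then show ?case using insert p by simp
  qed
  from this[of "Poly_Mapping.keys a"] show ?thesis
    by (simp flip: poly_mapping_sum_single)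
qed

section \<open>Quotients by generated ideals and their representations\<close>

locale presentation =
  fixes G :: "'g set" and R :: "'g falg set"
  assumes rels: "R \<subseteq> fcar G"
begin

abbreviation "cls \<equiv> pres_cls G R"
abbreviation "I \<equiv> Idl\<^bsub>free_alg G\<^esub> R"

lemma ideal_I: "ideal I (free_alg G)"
  by (rule ring.genideal_ideal[OF ring_free_alg rels])

lemma ring_pres: "ring (pres_alg G R)"
  unfolding pres_alg_def by (rule ideal.quotient_is_ring[OF ideal_I])

lemma cls_hom: "cls \<in> ring_hom (free_alg G) (pres_alg G R)"
  using ideal.rcos_ring_hom[OF ideal_I] unfolding pres_alg_def pres_cls_def by simp

lemma carrier_pres: "carrier (pres_alg G R) = cls ` fcar G"
  by (auto simp: pres_alg_def pres_cls_def FactRing_def A_RCOSETS_def')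

lemma cls_carrier [simp]: "a \<in> fcar G \<Longrightarrow> cls a \<in> carrier (pres_alg G R)"
  by (auto simp: carrier_pres)

lemma cls_mult: "a \<in> fcar G \<Longrightarrow> b \<in> fcar G \<Longrightarrow> cls a \<otimes>\<^bsub>pres_alg G R\<^esub> cls b = cls (a * b)"
  and cls_add: "a \<in> fcar G \<Longrightarrow> b \<in> fcar G \<Longrightarrow> cls a \<oplus>\<^bsub>pres_alg G R\<^esub> cls b = cls (a + b)"
  and cls_one: "\<one>\<^bsub>pres_alg G R\<^esub> = cls 1"
  using ring_hom_mult[OF cls_hom] ring_hom_add[OF cls_hom] ring_hom_one[OF cls_hom]
  by (auto simp: free_alg_simps)

lemma cls_zero: "\<zero>\<^bsub>pres_alg G R\<^esub> = cls 0"
  using ring_hom_zero[OF cls_hom ring_free_alg ring_pres] by (simp add: free_alg_simps)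

lemma cls_uminus: "a \<in> fcar G \<Longrightarrow> \<ominus>\<^bsub>pres_alg G R\<^esub> cls a = cls (- a)"
  by (rule abelian_group.minus_equality[OF ring.is_abelian_group[OF ring_pres]])
     (auto simp: cls_add cls_zero)

lemma cls_eq_iff: "a \<in> fcar G \<Longrightarrow> b \<in> fcar G \<Longrightarrow> cls a = cls b \<longleftrightarrow> a - b \<in> I"
  using ring.quotient_eq_iff_same_a_r_cos[OF ring_free_alg ideal_I, of a b]
  by (auto simp: pres_cls_def a_minus_def a_inv_free_alg free_alg_simps)

lemma cls_rel: "a - b \<in> R \<Longrightarrow> a \<in> fcar G \<Longrightarrow> b \<in> fcar G \<Longrightarrow> cls a = cls b"
  using ring.genideal_self[OF ring_free_alg rels] by (auto simp: cls_eq_iff)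

end

text \<open>The elements of the free algebra killed by \<open>ev\<close> form an ideal, and an ideal
  containing the relations contains everything they generate. This lets a representation of the free
  algebra descend to the quotient.\<close>

lemma (in alg_rep) ev_cls_eq:
  assumes "presentation G R" "\<And>r. r \<in> R \<Longrightarrow> ev r = 0"
    and "pres_cls G R a = pres_cls G R b" "a \<in> fcar G" "b \<in> fcar G"
  shows "ev a = ev b"
proof -
  interpret presentation G R by fact
  have "ideal {a \<in> fcar G. ev a = 0} (free_alg G)"
  proof (rule idealI)
    show "subgroup {a \<in> fcar G. ev a = 0} (add_monoid (free_alg G))"
    proof (rule group.subgroupI[OF abelian_group.a_group[OF ring.is_abelian_group[OF ring_free_alg]]])
      fix a assume "a \<in> {a \<in> fcar G. ev a = 0}"
      then show "inv\<^bsub>add_monoid (free_alg G)\<^esub> a \<in> {a \<in> fcar G. ev a = 0}"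
        using a_inv_free_alg[of a G, unfolded a_inv_def] by simp
    qed (auto simp: free_alg_simps intro: exI[of _ 0])
  qed (auto simp: free_alg_simps ring_free_alg)
  then have "I \<subseteq> {a \<in> fcar G. ev a = 0}"
    using rels assms(2) by (intro ring.genideal_minimal[OF ring_free_alg]) auto
  moreover have "a - b \<in> I" using assms(3-5) cls_eq_iff by simp
  ultimately show ?thesis by auto
qed

section \<open>Signed permutations\<close>

lemma B_carrier_iff: "w \<in> carrier B_group \<longleftrightarrow> bij (fst w) \<and> (\<forall>i. snd w i \<in> {1, -1})"
  by (cases w) (simp add: B_group_def)

lemma B_mult: "w \<otimes>\<^bsub>B_group\<^esub> w' = (fst w \<circ> fst w', \<lambda>i. snd w' i * snd w (fst w' i))"
  by (cases w; cases w') (simp add: B_group_def)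

lemma B_one: "\<one>\<^bsub>B_group\<^esub> = (id, \<lambda>_. 1)"
  by (simp add: B_group_def)

lemma sign_cases: "w \<in> carrier B_group \<Longrightarrow> snd w i = 1 \<or> snd w i = -1"
  by (auto simp: B_carrier_iff)

lemma group_B_group: "group B_group"
proof (rule groupI)
  fix x y z :: "'a sperm"
  assume x: "x \<in> carrier B_group"
  \<comment> \<open>The inverse of a signed permutation reads the signs at the preimages, since each
    sign is its own inverse.\<close>
  let ?y = "(inv_into UNIV (fst x), \<lambda>i. snd x (inv_into UNIV (fst x) i))"
  have "?y \<in> carrier B_group"
    using x by (auto simp: B_carrier_iff bij_imp_bij_inv)
  moreover have "snd x i * snd x i = 1" for i
    using sign_cases[OF x, of i] by auto
  then have "?y \<otimes>\<^bsub>B_group\<^esub> x = \<one>\<^bsub>B_group\<^esub>"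
    using x by (auto simp: B_mult B_one B_carrier_iff bij_is_inj fun_eq_iff)
  ultimately show "\<exists>y\<in>carrier B_group. y \<otimes>\<^bsub>B_group\<^esub> x = \<one>\<^bsub>B_group\<^esub>" by blast
  show "x \<otimes>\<^bsub>B_group\<^esub> y \<in> carrier B_group" if y: "y \<in> carrier B_group"
  proof -
    have "snd y i * snd x (fst y i) \<in> {1, -1}" for i
      using sign_cases[OF y, of i] sign_cases[OF x, of "fst y i"] by auto
    then show ?thesis using x y by (simp add: B_carrier_iff B_mult bij_comp)
  qed
  show "x \<otimes>\<^bsub>B_group\<^esub> y \<otimes>\<^bsub>B_group\<^esub> z = x \<otimes>\<^bsub>B_group\<^esub> (y \<otimes>\<^bsub>B_group\<^esub> z)"
    by (auto simp: B_mult)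
  show "\<one>\<^bsub>B_group\<^esub> \<otimes>\<^bsub>B_group\<^esub> x = x" by (simp add: B_mult B_one)
qed (simp_all add: B_carrier_iff B_one)

interpretation B: group B_group by (rule group_B_group)

lemma refl_carrier [simp]:
  "s_refl i j \<in> carrier B_group" "sbar_refl i j \<in> carrier B_group" "tau_refl i \<in> carrier B_group"
  by (auto simp: B_carrier_iff s_refl_def sbar_refl_def tau_refl_def)

lemma refl_commute: "s_refl i j = s_refl j i" "sbar_refl i j = sbar_refl j i"
  by (auto simp: s_refl_def sbar_refl_def transpose_commute)

lemma conj_transpose:
  "w \<in> carrier B_group \<Longrightarrow>
    fst w \<circ> Transposition.transpose i k = Transposition.transpose (fst w i) (fst w k) \<circ> fst w"
  by (auto simp: B_carrier_iff fun_eq_iff Transposition.transpose_def bij_def inj_eq)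

text \<open>\<open>s_refl i k\<close> and \<open>sbar_refl i k\<close> are the reflections in e_i -
  e_k and e_i + e_k. Up to sign, \<open>w\<close> maps such a vector to one of the same kind when
  the signs at \<open>i\<close> and \<open>k\<close> agree, and to one of the other kind when they
  differ.\<close>

lemma conj_refl:
  assumes w: "w \<in> carrier B_group"
  shows "w \<otimes>\<^bsub>B_group\<^esub> s_refl i k =
      (if snd w i = snd w k then s_refl (fst w i) (fst w k) else sbar_refl (fst w i) (fst w k))
        \<otimes>\<^bsub>B_group\<^esub> w"
    and "w \<otimes>\<^bsub>B_group\<^esub> sbar_refl i k =
      (if snd w i = snd w k then sbar_refl (fst w i) (fst w k) else s_refl (fst w i) (fst w k))
        \<otimes>\<^bsub>B_group\<^esub> w"
    and "w \<otimes>\<^bsub>B_group\<^esub> tau_refl i = tau_refl (fst w i) \<otimes>\<^bsub>B_group\<^esub> w"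
proof -
  have sg: "snd w i \<noteq> snd w k \<Longrightarrow> snd w k = - snd w i \<and> snd w i = - snd w k"
    using sign_cases[OF w, of i] sign_cases[OF w, of k] by auto
  show "w \<otimes>\<^bsub>B_group\<^esub> s_refl i k =
      (if snd w i = snd w k then s_refl (fst w i) (fst w k) else sbar_refl (fst w i) (fst w k))
        \<otimes>\<^bsub>B_group\<^esub> w"
    "w \<otimes>\<^bsub>B_group\<^esub> sbar_refl i k =
      (if snd w i = snd w k then sbar_refl (fst w i) (fst w k) else s_refl (fst w i) (fst w k))
        \<otimes>\<^bsub>B_group\<^esub> w"
    "w \<otimes>\<^bsub>B_group\<^esub> tau_refl i = tau_refl (fst w i) \<otimes>\<^bsub>B_group\<^esub> w"
  using w sg conj_transpose[OF w, of i k]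
  by (auto simp: B_mult s_refl_def sbar_refl_def tau_refl_def fun_eq_iff B_carrier_iff bij_def inj_eq
      Transposition.transpose_def)
qed

lemma tau_tau_s:
  assumes "i \<noteq> k"
  shows "tau_refl k \<otimes>\<^bsub>B_group\<^esub> (tau_refl i \<otimes>\<^bsub>B_group\<^esub> s_refl k i) = sbar_refl k i"
    and "tau_refl k \<otimes>\<^bsub>B_group\<^esub> (tau_refl i \<otimes>\<^bsub>B_group\<^esub> sbar_refl k i) = s_refl k i"
  using assms by (auto simp: B_mult s_refl_def sbar_refl_def tau_refl_def fun_eq_iff
      Transposition.transpose_def)

lemma tau_tau [simp]: "tau_refl i \<otimes>\<^bsub>B_group\<^esub> tau_refl i = \<one>\<^bsub>B_group\<^esub>"
  by (auto simp: B_mult B_one tau_refl_def fun_eq_iff)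


section \<open>Polynomials and divided differences\<close>

text \<open>Exponents are raised one variable at a time, so each step is a multiplication by some
  x_j, the form in which the commutation rules are available.\<close>

lemma monomial_induct [case_names zero step]:
  fixes a :: "'n \<Rightarrow>\<^sub>0 nat"
  assumes "P 0" "\<And>a j. P a \<Longrightarrow> P (Poly_Mapping.single j 1 + a)"
  shows "P a"
proof (induction a rule: update_induct)
  case (update f a b)
  have "Poly_Mapping.update a b f = Poly_Mapping.single a b + f"
    using update by (simp add: update_eq_add_single add.commute)
  moreover have "P (Poly_Mapping.single a b + f)" for b
  proof (induction b)
    case (Suc b)
    have "Poly_Mapping.single a (Suc b) + f = Poly_Mapping.single a 1 + (Poly_Mapping.single a b + f)"
      by (metis add.assoc plus_1_eq_Suc single_add)
    then show ?case using assms(2)[OF Suc] by simp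
  qed (use update in simp)
  ultimately show ?case by simp
qed (use assms in simp)

lemma single_eq_pvar_mult:
  "Poly_Mapping.single (Poly_Mapping.single j 1 + a) z = pvar j * Poly_Mapping.single a z"
  by (simp add: pvar_def mult_single)

lemma cpoly_induct [case_names const add pvar]:
  fixes f :: "'n cpoly"
  assumes c: "\<And>z. P (Poly_Mapping.single 0 z)"
    and a: "\<And>f g. P f \<Longrightarrow> P g \<Longrightarrow> P (f + g)"
    and x: "\<And>j f. P f \<Longrightarrow> P (pvar j * f)"
  shows "P f"
proof -
  have s: "P (Poly_Mapping.single a z)" for a z
    by (induction a rule: monomial_induct) (use c x in \<open>simp_all add: single_eq_pvar_mult del: One_nat_def\<close>)
  show ?thesis
  proof (induction f rule: update_induct)
    case const
    show ?case using c[of 0] by simp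
  next
    case (update f a b)
    have "Poly_Mapping.update a b f = f + Poly_Mapping.single a b"
      using update by (simp add: update_eq_add_single add.commute)
    then show ?case using a s update by simp
  qed
qed

section \<open>Signed permutations acting on polynomials\<close>

context
  fixes w :: "'n::finite sperm"
begin

lemma poly_act_single: "poly_act w (Poly_Mapping.single a z) =
    Poly_Mapping.single 0 z * (\<Prod>i\<in>UNIV. signed_act w pvar i ^ Poly_Mapping.lookup a i)"
  by (cases "z = 0") (simp_all add: poly_act_def)

lemma poly_act_const: "poly_act w (Poly_Mapping.single 0 z) = Poly_Mapping.single 0 z"
  by (simp add: poly_act_single)

lemma poly_act_one: "poly_act w 1 = 1"
  using poly_act_const[of 1] by simp

lemma poly_act_zero: "poly_act w 0 = 0"
  by (simp add: poly_act_def)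

lemma poly_act_add: "poly_act w (f + g) = poly_act w f + poly_act w g"
  unfolding poly_act_def by (rule sum_keys_add) (auto simp: single_add distrib_right)

lemma poly_act_mult: "poly_act w (f * g) = poly_act w f * poly_act w g"
proof (rule additive_poly_mapping_eqI[of "\<lambda>f. poly_act w (f * g)" "\<lambda>f. poly_act w f * poly_act w g"])
  fix a y
  show "poly_act w (Poly_Mapping.single a y * g) = poly_act w (Poly_Mapping.single a y) * poly_act w g"
  proof (rule additive_poly_mapping_eqI[of "\<lambda>g. poly_act w (Poly_Mapping.single a y * g)"
        "\<lambda>g. poly_act w (Poly_Mapping.single a y) * poly_act w g"])
    fix b z
    have "poly_act w (Poly_Mapping.single a y * Poly_Mapping.single b z)
        = Poly_Mapping.single 0 (y * z) * ((\<Prod>i\<in>UNIV. signed_act w pvar i ^ Poly_Mapping.lookup a i)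
          * (\<Prod>i\<in>UNIV. signed_act w pvar i ^ Poly_Mapping.lookup b i))"
      by (simp add: mult_single[of a] poly_act_single lookup_add power_add prod.distrib)
    also have "Poly_Mapping.single 0 (y * z) = Poly_Mapping.single (0::'n \<Rightarrow>\<^sub>0 nat) y * Poly_Mapping.single 0 z"
      by (simp add: mult_single)
    finally show "poly_act w (Poly_Mapping.single a y * Poly_Mapping.single b z)
        = poly_act w (Poly_Mapping.single a y) * poly_act w (Poly_Mapping.single b z)"
      by (simp only: poly_act_single mult_ac)
  qed (simp_all add: distrib_left distrib_right poly_act_add)
qed (simp_all add: distrib_left distrib_right poly_act_add)

lemma poly_act_uminus: "poly_act w (- f) = - poly_act w f"
  using poly_act_add[of f "- f"] by (simp add: poly_act_zero eq_neg_iff_add_eq_0 add.commute)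

lemma poly_act_pvar: "poly_act w (pvar j) = signed_act w pvar j"
proof -
  have "(\<Prod>i\<in>UNIV. signed_act w pvar i ^ Poly_Mapping.lookup (Poly_Mapping.single j 1) i)
      = (\<Prod>i\<in>UNIV. if i = j then signed_act w (pvar :: 'n \<Rightarrow> 'n cpoly) i else 1)"
    by (rule prod.cong) (auto simp: lookup_single when_def)
  then show ?thesis by (simp add: pvar_def[of j] poly_act_single)
qed

end

text \<open>Both sides respect sums and products, so only variables matter. There the signs of
  \<open>w'\<close> and \<open>w\<close> multiply exactly as in the group law, which makes this a
  left action.\<close>

lemma poly_act_comp:
  assumes "w \<in> carrier B_group" "w' \<in> carrier B_group"
  shows "poly_act w (poly_act w' f) = poly_act (w \<otimes>\<^bsub>B_group\<^esub> w') f"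
proof (induction f rule: cpoly_induct)
  case (pvar j f)
  have "poly_act w (signed_act w' pvar j) = signed_act (w \<otimes>\<^bsub>B_group\<^esub> w') pvar j"
    using sign_cases[OF assms(1), of "fst w' j"] sign_cases[OF assms(2), of j]
    by (auto simp: signed_act_def B_mult poly_act_uminus poly_act_pvar)
  then show ?case by (simp add: poly_act_mult poly_act_pvar pvar)
qed (simp_all add: poly_act_const poly_act_add)

lemma poly_act_id: "poly_act \<one>\<^bsub>B_group\<^esub> f = f"
  by (induction f rule: cpoly_induct)
     (simp_all add: poly_act_const poly_act_add poly_act_mult poly_act_pvar B_one signed_act_def)

section \<open>Exact quotients and divided differences\<close>

lemma pquot_eqI:
  fixes f g q :: "'n::linorder cpoly"
  assumes "g \<noteq> 0" "f = g * q"
  shows "pquot f g = q"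
  \<comment> \<open>Uniqueness cancels \<open>g\<close>: polynomials have no zero divisors, which
    rests on the linear order that the monomials inherit from the index type.\<close>
  unfolding pquot_def using assms by (intro the_equality) auto

text \<open>Divisibility is certified on the variables only, and \<open>c j\<close> is the divided
  difference of x_j. One argument then covers s, sbar and \<tau> with the linear forms x_i - x_k,
  x_i + x_k and 2 x_i.\<close>

definition skew_pair :: "'n::finite sperm \<Rightarrow> 'n cpoly \<Rightarrow> ('n \<Rightarrow> 'n cpoly) \<Rightarrow> bool" where
  "skew_pair w g c \<longleftrightarrow> g \<noteq> 0 \<and> (\<forall>j. pvar j - signed_act w pvar j = g * c j)"

definition ddiff :: "'n::finite sperm \<Rightarrow> 'n cpoly \<Rightarrow> 'n cpoly \<Rightarrow> 'n cpoly" where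
  "ddiff w g f = pquot (f - poly_act w f) g"

context
  fixes w :: "'n::{finite,linorder} sperm" and g c
  assumes sp: "skew_pair w g c"
begin

text \<open>Twisted Leibniz rule: a b - w(a b) = a (b - w b) + (a - w a) w b, with \<open>a\<close>
  a variable.\<close>

lemma skew_pair_step:
  "f - poly_act w f = g * q \<Longrightarrow>
    pvar j * f - poly_act w (pvar j * f) = g * (pvar j * q + c j * poly_act w f)"
proof -
  assume q: "f - poly_act w f = g * q"
  have c: "pvar j - signed_act w pvar j = g * c j" using sp by (simp add: skew_pair_def)
  have "pvar j * f - poly_act w (pvar j * f)
      = pvar j * (f - poly_act w f) + (pvar j - signed_act w pvar j) * poly_act w f"
    by (simp add: poly_act_mult poly_act_pvar algebra_simps)
  also have "\<dots> = g * (pvar j * q + c j * poly_act w f)"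
    unfolding q c distrib_left by (simp only: mult_ac)
  finally show ?thesis .
qed

lemma skew_pair_dvd: "\<exists>q. f - poly_act w f = g * q"
proof (induction f rule: cpoly_induct)
  case (const z)
  show ?case by (intro exI[of _ 0]) (simp add: poly_act_const)
next
  case (add f h)
  then obtain q r where "f - poly_act w f = g * q" "h - poly_act w h = g * r" by blast
  then show ?case by (intro exI[of _ "q + r"]) (simp add: poly_act_add algebra_simps)
next
  case (pvar j f)
  then show ?case using skew_pair_step by blast
qed

lemma ddiff_eqI: "f - poly_act w f = g * q \<Longrightarrow> ddiff w g f = q"
  using sp unfolding ddiff_def skew_pair_def by (intro pquot_eqI) auto

lemma ddiff_spec: "f - poly_act w f = g * ddiff w g f"
  using skew_pair_dvd[of f] ddiff_eqI by metis

lemma ddiff_add: "ddiff w g (f + h) = ddiff w g f + ddiff w g h"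
  using ddiff_spec[of f] ddiff_spec[of h]
  by (intro ddiff_eqI) (simp add: poly_act_add algebra_simps)

lemma ddiff_pvar: "ddiff w g (pvar j * f) = pvar j * ddiff w g f + c j * poly_act w f"
  by (intro ddiff_eqI skew_pair_step ddiff_spec)

lemma ddiff_const: "ddiff w g (Poly_Mapping.single 0 z) = 0"
  by (intro ddiff_eqI) (simp add: poly_act_const)

text \<open>Constants are fixed by \<open>w\<close> and pass through the quotient. This complex
  linearity is what tensoring with \<open>M\<close> over the complex numbers requires.\<close>

lemma ddiff_scale: "ddiff w g (Poly_Mapping.single 0 z * f) = Poly_Mapping.single 0 z * ddiff w g f"
proof (rule ddiff_eqI)
  have "Poly_Mapping.single 0 z * f - poly_act w (Poly_Mapping.single 0 z * f)
      = Poly_Mapping.single 0 z * (f - poly_act w f)"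
    by (simp add: poly_act_mult poly_act_const algebra_simps)
  then show "Poly_Mapping.single 0 z * f - poly_act w (Poly_Mapping.single 0 z * f)
      = g * (Poly_Mapping.single 0 z * ddiff w g f)"
    using ddiff_spec[of f] by (simp add: mult_ac)
qed

end

lemma single_1_eq_iff: "Poly_Mapping.single i (1::nat) = Poly_Mapping.single k 1 \<longleftrightarrow> i = k"
proof
  assume "Poly_Mapping.single i (1::nat) = Poly_Mapping.single k 1"
  then have "Poly_Mapping.keys (Poly_Mapping.single i (1::nat)) = Poly_Mapping.keys (Poly_Mapping.single k (1::nat))"
    by simp
  then show "i = k" by simp
qed simp

lemma lookup_pvar: "Poly_Mapping.lookup (pvar k) (Poly_Mapping.single i 1) = (if i = k then 1 else 0)"
  using single_1_eq_iff[of k i] by (auto simp: pvar_def lookup_single when_def)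

text \<open>In both forms the coefficient at the monomial x_i is 1, because x_k contributes nothing
  there.\<close>

lemma root_nonzero:
  assumes "i \<noteq> k"
  shows "pvar i - pvar k \<noteq> 0" "pvar i + pvar k \<noteq> 0"
proof -
  have *: "g \<noteq> 0" if "Poly_Mapping.lookup g (Poly_Mapping.single i 1) \<noteq> 0" for g :: "'a cpoly"
    using that by auto
  show "pvar i - pvar k \<noteq> 0" "pvar i + pvar k \<noteq> 0"
    by (rule *, simp only: lookup_minus lookup_add lookup_pvar, simp add: assms)+
qed

lemma double_pvar_nonzero: "2 * pvar i \<noteq> 0"
proof -
  have "Poly_Mapping.lookup (pvar i + pvar i) (Poly_Mapping.single i 1) \<noteq> 0"
    by (simp only: lookup_add lookup_pvar) simp
  then show ?thesis unfolding mult_2 by auto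
qed

lemma skew_pairs:
  assumes "i \<noteq> k"
  shows "skew_pair (s_refl k i) (pvar i - pvar k) (\<lambda>j. if j = i then 1 else if j = k then -1 else 0)"
    and "skew_pair (sbar_refl k i) (pvar i + pvar k) (\<lambda>j. if j = i \<or> j = k then 1 else 0)"
  unfolding skew_pair_def using assms
  by (intro conjI root_nonzero allI;
      simp add: signed_act_def s_refl_def sbar_refl_def Transposition.transpose_def)+

lemma skew_pair_tau: "skew_pair (tau_refl i) (2 * pvar i) (\<lambda>j. if j = i then 1 else 0)"
  unfolding skew_pair_def
  by (intro conjI double_pvar_nonzero allI) (simp add: signed_act_def tau_refl_def)

section \<open>Checking the relations that involve only \<open>y\<close>\<close>

text \<open>\<open>of_int\<close> belongs to \<open>ring_1\<close>, of which the endomorphisms are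
  not an instance, so a sign is applied by cases.\<close>

definition sg :: "int \<Rightarrow> 'e::ring \<Rightarrow> 'e" where
  "sg e x = (if e = 1 then x else - x)"

lemma sg_simps [simp]: "sg 1 x = x" "sg (-1) x = - x"
  by (simp_all add: sg_def)

lemma refl_sels [simp]:
  "fst (s_refl i k) = Transposition.transpose i k" "snd (s_refl i k) j = 1"
  "fst (sbar_refl i k) = Transposition.transpose i k"
  "snd (sbar_refl i k) j = (if j = i \<or> j = k then -1 else 1)"
  "fst (tau_refl i) = id" "snd (tau_refl i) j = (if j = i then -1 else 1)"
  by (simp_all add: s_refl_def sbar_refl_def tau_refl_def)

text \<open>In this locale \<open>kill\<close> stands for the operators on polynomials with coefficients in \<open>M\<close> that
  annihilate the constants: such an operator \<open>N\<close> vanishes as soon as every \<open>N x\<^sub>k\<close> is a left multiple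
  of \<open>N\<close>. Applied to the defects of the relations between \<open>y\<close> and \<open>c\<close>, \<open>W\<close> and \<open>y\<close>, this
  principle reduces them to identities between the commutators of \<open>y\<^sub>i\<close> and \<open>x\<^sub>k\<close>, which lie
  in the image of \<open>K\<close>.\<close>

locale dunkl_operators =
  fixes S :: "complex \<Rightarrow> 'e::{ring,monoid_mult}"
    and XX Y C :: "'n::finite \<Rightarrow> 'e" and W :: "'n sperm \<Rightarrow> 'e"
    and u v :: complex and kill :: "'e set"
  assumes SC: "S z * C i = C i * S z"
    and SW: "S z * W w = W w * S z"
    and SY: "S z * Y i = Y i * S z"
    and CC: "C i * C i = 1"
    and CaC: "i \<noteq> j \<Longrightarrow> C i * C j = - (C j * C i)"
    and WW: "w \<in> carrier B_group \<Longrightarrow> w' \<in> carrier B_group \<Longrightarrow> W w * W w' = W (w \<otimes>\<^bsub>B_group\<^esub> w')"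
    and WC: "w \<in> carrier B_group \<Longrightarrow> W w * C i = sg (snd w i) (C (fst w i)) * W w"
    and CX: "C j * XX k = (if j = k then - (XX k * C j) else XX k * C j)"
    and WX: "w \<in> carrier B_group \<Longrightarrow> W w * XX i = sg (snd w i) (XX (fst w i)) * W w"
    and YX_ne: "i \<noteq> k \<Longrightarrow> Y i * XX k = XX k * Y i
      + S u * ((1 + C i * C k) * W (s_refl i k) - (1 - C i * C k) * W (sbar_refl i k))"
    and YX_eq: "Y i * XX i = XX i * Y i
      + (- (S u * (\<Sum>k\<in>UNIV - {i}. (1 + C k * C i) * W (s_refl k i) + (1 - C k * C i) * W (sbar_refl k i)))
         - S (of_real (sqrt 2) * v) * W (tau_refl i))"
    and kill: "N \<in> kill \<Longrightarrow> (\<And>k. \<exists>Z. N * XX k = Z * N) \<Longrightarrow> N = 0"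
    and kill_Y: "Y i \<in> kill"
    and kill_left: "a \<in> kill \<Longrightarrow> b * a \<in> kill"
    and kill_C: "a \<in> kill \<Longrightarrow> a * C i \<in> kill"
    and kill_W: "a \<in> kill \<Longrightarrow> w \<in> carrier B_group \<Longrightarrow> a * W w \<in> kill"
    and kill_diff: "a \<in> kill \<Longrightarrow> b \<in> kill \<Longrightarrow> a - b \<in> kill"
begin

text \<open>\<open>Ep\<close> and \<open>Em\<close> are the two parts of the off-diagonal
  commutator, and \<open>Br i k\<close> is the commutator of \<open>Y i\<close> and
  \<open>XX k\<close> for all \<open>i\<close> and \<open>k\<close>. Diagonal and off-diagonal
  relations can then be used uniformly.\<close>

definition "Ep i k = (1 + C i * C k) * W (s_refl i k)"
definition "Em i k = (1 - C i * C k) * W (sbar_refl i k)"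
definition "Br i k = (if i = k then
    - (S u * (\<Sum>l\<in>UNIV - {i}. Ep l i + Em l i)) - S (of_real (sqrt 2) * v) * W (tau_refl i)
  else S u * (Ep i k - Em i k))"

lemma YX: "Y i * XX k = XX k * Y i + Br i k"
  unfolding Br_def Ep_def Em_def using YX_ne YX_eq by simp

lemma CC_left: "C i * (C i * z) = z"
  by (simp add: mult.assoc[symmetric] CC)

lemma CaC_left: "i \<noteq> j \<Longrightarrow> C i * (C j * z) = - (C j * (C i * z))"
  by (simp add: mult.assoc[symmetric] CaC[of i j])

lemma Ws_C: "W (s_refl i k) * C j = C (Transposition.transpose i k j) * W (s_refl i k)"
  using WC[OF refl_carrier(1), of i k j] by simp

lemma Wsbar_C: "W (sbar_refl i k) * C j =
    (if j = i \<or> j = k then - (C (Transposition.transpose i k j) * W (sbar_refl i k))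
     else C j * W (sbar_refl i k))"
  using WC[OF refl_carrier(2), of i k j] by auto

text \<open>Left multiplication by \<open>C i * C k\<close> and conjugation by the reflection each
  exchange \<open>C i\<close> and \<open>C k\<close> up to sign. The signs cancel for
  \<open>j = i\<close> and leave -1 for \<open>j = k\<close>, which is also the sign with which
  \<open>C j\<close> passes \<open>XX k\<close>.\<close>

lemma C_E:
  assumes "i \<noteq> k"
  shows "C j * Ep i k = (if j = k then - (Ep i k * C j) else Ep i k * C j)"
    and "C j * Em i k = (if j = k then - (Em i k * C j) else Em i k * C j)"
proof -
  consider "j = i" | "j = k" | "j \<noteq> i" "j \<noteq> k" by blast
  then have "C j * Ep i k = (if j = k then - (Ep i k * C j) else Ep i k * C j) \<and>
     C j * Em i k = (if j = k then - (Em i k * C j) else Em i k * C j)"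
  proof cases
    case 1
    then show ?thesis using assms
      by (simp add: Ep_def Em_def algebra_simps Ws_C Wsbar_C CC CC_left CaC[of k i] CaC_left[of k i])
  next
    case 2
    then show ?thesis using assms
      by (simp add: Ep_def Em_def algebra_simps Ws_C Wsbar_C CC CC_left CaC[of k i] CaC_left[of k i])
  next
    case 3
    then show ?thesis using assms
      by (simp add: Ep_def Em_def algebra_simps Ws_C Wsbar_C CaC[of j k] CaC_left[of j k]
          CaC_left[of j i] Transposition.transpose_def)
  qed
  then show "C j * Ep i k = (if j = k then - (Ep i k * C j) else Ep i k * C j)"
    "C j * Em i k = (if j = k then - (Em i k * C j) else Em i k * C j)" by auto
qed

text \<open>Moving \<open>W w\<close> past \<open>C i * C k\<close> produces the product of the two
  signs, and moving it past the reflection exchanges s and sbar exactly when that product is -1.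
  Together the two effects exchange \<open>Ep\<close> and \<open>Em\<close>.\<close>

lemma W_E:
  assumes w: "w \<in> carrier B_group"
  shows "W w * Ep i k =
      (if snd w i = snd w k then Ep (fst w i) (fst w k) else Em (fst w i) (fst w k)) * W w"
    and "W w * Em i k =
      (if snd w i = snd w k then Em (fst w i) (fst w k) else Ep (fst w i) (fst w k)) * W w"
proof -
  have "W w * (C j * z) = sg (snd w j) (C (fst w j)) * (W w * z)" for j z
    using WC[OF w, of j] by (simp add: mult.assoc[symmetric])
  then have CCw: "W w * (C i * (C k * z)) =
      sg (snd w i) (sg (snd w k) (C (fst w i) * (C (fst w k) * (W w * z))))" for z
    using sign_cases[OF w, of i] sign_cases[OF w, of k] by auto
  have Ws: "W w * W (s_refl i k) = (if snd w i = snd w k then W (s_refl (fst w i) (fst w k)) * W w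
      else W (sbar_refl (fst w i) (fst w k)) * W w)"
    using w by (simp add: WW conj_refl)
  have Wsb: "W w * W (sbar_refl i k) = (if snd w i = snd w k then W (sbar_refl (fst w i) (fst w k)) * W w
      else W (s_refl (fst w i) (fst w k)) * W w)"
    using w by (simp add: WW conj_refl)
  show "W w * Ep i k =
      (if snd w i = snd w k then Ep (fst w i) (fst w k) else Em (fst w i) (fst w k)) * W w"
    using sign_cases[OF w, of i] sign_cases[OF w, of k]
    by (auto simp: Ep_def Em_def algebra_simps CCw Ws)
  show "W w * Em i k =
      (if snd w i = snd w k then Em (fst w i) (fst w k) else Ep (fst w i) (fst w k)) * W w"
    using sign_cases[OF w, of i] sign_cases[OF w, of k]
    by (auto simp: Ep_def Em_def algebra_simps CCw Wsb)
qed

lemma C_S_left: "C i * (S z * a) = S z * (C i * a)"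
  by (simp add: mult.assoc[symmetric] SC)

lemma W_S_left: "W w * (S z * a) = S z * (W w * a)"
  by (simp add: mult.assoc[symmetric] SW)

lemma Y_S_left: "Y i * (S z * a) = S z * (Y i * a)"
  by (simp add: mult.assoc[symmetric] SY)

lemma W_tau_C: "W (tau_refl i) * C j = (if j = i then - (C j * W (tau_refl i)) else C j * W (tau_refl i))"
  using WC[OF refl_carrier(3), of i j] by auto

lemma C_Br: "C j * Br i k = (if j = k then - (Br i k * C j) else Br i k * C j)"
proof (cases "i = k")
  case False
  then show ?thesis by (simp add: Br_def C_S_left algebra_simps C_E)
next
  case True
  have "C j * (\<Sum>l\<in>UNIV - {k}. Ep l k + Em l k)
      = sg (if j = k then -1 else 1) ((\<Sum>l\<in>UNIV - {k}. Ep l k + Em l k) * C j)"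
    unfolding sum_distrib_left sum_distrib_right sg_def
    by (auto simp: distrib_left distrib_right C_E sum_negf[symmetric] intro!: sum.cong)
  then show ?thesis using True
    by (auto simp: Br_def C_S_left right_diff_distrib left_diff_distrib mult.assoc W_tau_C)
qed

text \<open>On the diagonal the summation index is carried along by the permutation. A summand may
  have \<open>Ep\<close> and \<open>Em\<close> exchanged, but they enter with the same coefficient,
  so their sum is stable; the two equal signs cancel.\<close>

lemma W_Br:
  assumes w: "w \<in> carrier B_group"
  shows "W w * Br i k = sg (snd w i) (sg (snd w k) (Br (fst w i) (fst w k))) * W w"
proof (cases "i = k")
  case False
  then have "fst w i \<noteq> fst w k" using w by (auto simp: B_carrier_iff bij_def inj_eq)
  with False show ?thesis using sign_cases[OF w, of i] sign_cases[OF w, of k]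
    by (auto simp: Br_def W_S_left right_diff_distrib left_diff_distrib mult.assoc W_E w)
next
  case True
  have bij: "bij_betw (fst w) (UNIV - {k}) (UNIV - {fst w k})"
    using w by (intro bij_betw_DiffI) (auto simp: B_carrier_iff)
  have "W w * (\<Sum>l\<in>UNIV - {k}. Ep l k + Em l k)
      = (\<Sum>l\<in>UNIV - {k}. (Ep (fst w l) (fst w k) + Em (fst w l) (fst w k)) * W w)"
    unfolding sum_distrib_left using w by (intro sum.cong) (auto simp: algebra_simps W_E)
  also have "\<dots> = (\<Sum>l\<in>UNIV - {fst w k}. Ep l (fst w k) + Em l (fst w k)) * W w"
    unfolding sum_distrib_right
    by (rule sum.reindex_bij_betw[OF bij, of "\<lambda>l. (Ep l (fst w k) + Em l (fst w k)) * W w"])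
  finally have *: "W w * (\<Sum>l\<in>UNIV - {k}. Ep l k + Em l k)
      = (\<Sum>l\<in>UNIV - {fst w k}. Ep l (fst w k) + Em l (fst w k)) * W w" .
  have "W w * W (tau_refl k) = W (tau_refl (fst w k)) * W w"
    using w by (simp add: WW conj_refl)
  with * True show ?thesis using sign_cases[OF w, of k]
    by (auto simp: Br_def W_S_left right_diff_distrib left_diff_distrib mult.assoc)
qed

text \<open>The defect N satisfies N x_k = - x_k N for k = j and N x_k = x_k N otherwise, since the
  commutator terms cancel by \<open>C_Br\<close>.\<close>

lemma YC: "Y i * C j = C j * Y i"
proof -
  let ?N = "Y i * C j - C j * Y i"
  have "?N = 0"
  proof (rule kill)
    show "?N \<in> kill" by (intro kill_diff kill_C kill_left kill_Y)
    fix k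
    have YXl: "Y i * (XX k * z) = XX k * (Y i * z) + Br i k * z" for z
      using YX[of i k] by (simp add: mult.assoc[symmetric] distrib_right)
    have CXl: "C j * (XX k * z) = (if j = k then - (XX k * (C j * z)) else XX k * (C j * z))" for z
      using CX[of j k] by (simp add: mult.assoc[symmetric])
    show "\<exists>Z. ?N * XX k = Z * ?N"
    proof (cases "j = k")
      case True
      then have "?N * XX k = (- XX k) * ?N"
        using C_Br[of k i k] CXl[unfolded True]
        by (simp add: left_diff_distrib right_diff_distrib distrib_left mult.assoc YX YXl CX)
      then show ?thesis by blast
    next
      case False
      then have "?N * XX k = XX k * ?N"
        using C_Br[of j i k] by (simp add: left_diff_distrib right_diff_distrib distrib_left mult.assoc YX YXl CX CXl)
      then show ?thesis by blast
    qed
  qed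
  then show ?thesis by simp
qed

lemma WY:
  assumes w: "w \<in> carrier B_group"
  shows "W w * Y i = sg (snd w i) (Y (fst w i)) * W w"
proof -
  let ?N = "W w * Y i - sg (snd w i) (Y (fst w i)) * W w"
  have "?N = 0"
  proof (rule kill)
    \<comment> \<open>\<open>kill\<close> is closed under left multiplication, so the sign is
      rewritten as a left factor.\<close>
    have "sg (snd w i) (Y (fst w i)) * W w = sg (snd w i) 1 * (Y (fst w i) * W w)"
      by (simp add: sg_def)
    then show "?N \<in> kill"
      using w by (simp add: kill_diff kill_left kill_W kill_Y)
    fix k
    have WXl: "W w * (XX k * z) = sg (snd w k) (XX (fst w k)) * (W w * z)" for z
      using WX[OF w, of k] by (simp add: mult.assoc[symmetric])
    have YXl: "Y (fst w i) * (XX (fst w k) * z) = XX (fst w k) * (Y (fst w i) * z) + Br (fst w i) (fst w k) * z" for z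
      using YX[of "fst w i" "fst w k"] by (simp add: mult.assoc[symmetric] distrib_right)
    have "?N * XX k = sg (snd w k) (XX (fst w k)) * ?N"
      using sign_cases[OF w, of i] sign_cases[OF w, of k] W_Br[OF w, of i k]
      by (elim disjE) (simp_all add: left_diff_distrib right_diff_distrib distrib_left distrib_right mult.assoc
          YX WXl WX[OF w] YXl)
    then show "\<exists>Z. ?N * XX k = Z * ?N" by blast
  qed
  then show ?thesis by simp
qed

lemma C_Y_left: "C j * (Y i * z) = Y i * (C j * z)"
  by (simp add: mult.assoc[symmetric] YC)

lemma Ep_Y: "Ep i k * Y j = Y (Transposition.transpose i k j) * Ep i k"
proof -
  have "W (s_refl i k) * Y j = Y (Transposition.transpose i k j) * W (s_refl i k)"
    using WY[OF refl_carrier(1), of i k j] by simp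
  then show ?thesis by (simp add: Ep_def algebra_simps C_Y_left)
qed

lemma Em_Y: "Em i k * Y j = (if j = i \<or> j = k then - (Y (Transposition.transpose i k j) * Em i k)
    else Y j * Em i k)"
proof -
  have "W (sbar_refl i k) * Y j = (if j = i \<or> j = k
    then - (Y (Transposition.transpose i k j) * W (sbar_refl i k)) else Y j * W (sbar_refl i k))"
    using WY[OF refl_carrier(2), of i k j] by auto
  then show ?thesis by (auto simp: Em_def algebra_simps C_Y_left)
qed

text \<open>\<tau>_i and the reflections in the summands with l different from j fix the index j, so
  they commute with \<open>Y j\<close>. Only the summand l = j survives, and it matches the
  off-diagonal side.\<close>

lemma Br_Y_eq:
  assumes "i \<noteq> j"
  shows "Br i i * Y j - Y j * Br i i = Br j i * Y i - Y i * Br j i"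
proof -
  let ?R = "\<Sum>l\<in>UNIV - {i} - {j}. Ep l i + Em l i"
  have split: "(\<Sum>l\<in>UNIV - {i}. Ep l i + Em l i) = Ep j i + Em j i + ?R"
    using assms by (subst sum.remove[of _ j]) auto
  have R: "?R * Y j = Y j * ?R"
    unfolding sum_distrib_left sum_distrib_right
    using assms by (intro sum.cong) (auto simp: algebra_simps Ep_Y Em_Y Transposition.transpose_def)
  have T: "W (tau_refl i) * Y j = Y j * W (tau_refl i)"
    using WY[OF refl_carrier(3), of i j] assms by auto
  \<comment> \<open>An opaque name for the remaining sum keeps the rewriting below from distributing
    over it.\<close>
  obtain Q where Q: "Q = ?R" by blast
  have Bii: "Br i i = - (S u * (Ep j i + Em j i + Q)) - S (of_real (sqrt 2) * v) * W (tau_refl i)"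
    by (simp only: Br_def split Q simp_thms if_True)
  have Bji: "Br j i = S u * (Ep j i - Em j i)"
    using assms by (simp add: Br_def)
  show ?thesis
    unfolding Bii Bji using assms R[folded Q] by (simp add: Y_S_left algebra_simps T Ep_Y Em_Y)
qed

text \<open>This is what the Jacobi identity for y_i, y_j, x_k demands once y_i and y_j commute.
  When k differs from both i and j, the reflections in \<open>Br i k\<close> fix j and those in
  \<open>Br j k\<close> fix i, so both sides vanish.\<close>

lemma Br_Y_sym: "Br i k * Y j - Y j * Br i k = Br j k * Y i - Y i * Br j k"
proof -
  consider "i = j" | "i \<noteq> j" "k = i" | "i \<noteq> j" "k = j" | "i \<noteq> j" "k \<noteq> i" "k \<noteq> j" by blast
  then show ?thesis
  proof cases
    case 2
    then show ?thesis using Br_Y_eq by simp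
  next
    case 3
    then show ?thesis using Br_Y_eq[of j i] by simp
  next
    case 4
    then show ?thesis
      by (simp add: Br_def algebra_simps Y_S_left Ep_Y Em_Y Transposition.transpose_def)
  qed simp
qed

lemma YY: "Y i * Y j = Y j * Y i"
proof -
  let ?N = "Y i * Y j - Y j * Y i"
  have "?N = 0"
  proof (rule kill)
    show "?N \<in> kill" by (intro kill_diff kill_left kill_Y)
    fix k
    have YXl: "Y i * (XX k * z) = XX k * (Y i * z) + Br i k * z" for i z
      using YX[of i k] by (simp add: mult.assoc[symmetric] distrib_right)
    have "?N * XX k = XX k * ?N + ((Br i k * Y j - Y j * Br i k) - (Br j k * Y i - Y i * Br j k))"
      by (simp add: algebra_simps YX YXl)
    also have "\<dots> = XX k * ?N" using Br_Y_sym[of i k j] by simp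
    finally show "\<exists>Z. ?N * XX k = Z * ?N" by blast
  qed
  then show ?thesis by simp
qed

end

section \<open>The action on polynomials with coefficients in a \<open>K\<close>-module\<close>

lemma fscal_zero [simp]: "fscal 0 = 0" and fscal_one [simp]: "fscal 1 = 1"
  and fscal_add: "fscal (y + z) = fscal y + fscal z"
  and fscal_mult: "fscal (y * z) = fscal y * fscal z"
  by (simp_all add: fscal_def single_add mult_single)

lemma fscal_commute: "fscal z * a = a * fscal z"
  by (rule additive_poly_mapping_eqI) (simp_all add: fscal_def mult_single distrib_left distrib_right mult.commute)

lemma K_gens_iff [simp]: "GC i \<in> K_gens" "GW w \<in> K_gens \<longleftrightarrow> w \<in> carrier B_group"
  "GX i \<notin> K_gens" "GY i \<notin> K_gens"
  by (auto simp: K_gens_def)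

lemma H_gens_iff [simp]: "GC i \<in> H_gens" "GW w \<in> H_gens \<longleftrightarrow> w \<in> carrier B_group"
  "GX i \<in> H_gens" "GY i \<in> H_gens"
  by (auto simp: H_gens_def)

lemma signed_act_fcar: "w \<in> carrier B_group \<Longrightarrow> (\<And>j. g j \<in> fcar G) \<Longrightarrow> signed_act w g i \<in> fcar G"
  using sign_cases[of w i] by (intro fcar_signed) auto

lemma K_rels_fcar: "K_rels \<subseteq> fcar K_gens"
  by (auto simp: K_rels_def signed_act_fcar)

lemma K_subset_H: "fcar K_gens \<subseteq> fcar H_gens"
  by (rule fcar_mono) (auto simp: H_gens_def)

lemma H_rels_fcar: "H_rels u v \<subseteq> fcar H_gens"
  using K_rels_fcar K_subset_H
  by (auto simp: H_rels_def commutator_def signed_act_fcar intro!: fcar_diff fcar_sum fcar_add fcar_mult)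

interpretation K: presentation K_gens K_rels
  by standard (rule K_rels_fcar)

interpretation H: presentation H_gens "H_rels u v" for u v
  by standard (rule H_rels_fcar)

lemmas presentation_folds = K_cls_def[symmetric] K_alg_def[symmetric] H_cls_def[symmetric] H_alg_def[symmetric]

lemmas K_cls_simps = K.cls_carrier[unfolded presentation_folds] K.cls_add[unfolded presentation_folds]
  K.cls_mult[unfolded presentation_folds] K.cls_one[unfolded presentation_folds]
lemmas H_cls_simps = H.cls_carrier[unfolded presentation_folds] H.cls_add[unfolded presentation_folds]
  H.cls_mult[unfolded presentation_folds] H.cls_one[unfolded presentation_folds]

section \<open>Multiplications, substitutions and divided differences as operators\<close>

definition xP :: "'n::{finite,linorder} \<Rightarrow> 'n cpoly endo" where "xP j = Endo ((*) (pvar j))"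
definition aP :: "'n::{finite,linorder} sperm \<Rightarrow> 'n cpoly endo" where "aP w = Endo (poly_act w)"
definition dP :: "'n::{finite,linorder} sperm \<Rightarrow> 'n cpoly \<Rightarrow> 'n cpoly endo" where "dP w g = Endo (ddiff w g)"

text \<open>Elements of \<open>endo\<close> are only additive, so complex linearity is a separate
  property. Scalars are read as constant polynomials.\<close>

definition linP :: "'n::{finite,linorder} cpoly endo \<Rightarrow> bool" where
  "linP T \<longleftrightarrow> (\<forall>z f. app T (Poly_Mapping.single 0 z * f) = Poly_Mapping.single 0 z * app T f)"

lemma app_xP [simp]: "app (xP j) f = pvar j * f"
  by (simp add: xP_def app_Endo distrib_left)

lemma app_aP [simp]: "app (aP w) f = poly_act w f"
  by (simp add: aP_def app_Endo poly_act_add)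

lemma app_dP: "skew_pair w g c \<Longrightarrow> app (dP w g) f = ddiff w g f"
  by (simp add: dP_def app_Endo ddiff_add)

lemma linP_xP [simp]: "linP (xP j)"
  by (simp add: linP_def mult_ac)

lemma linP_aP [simp]: "linP (aP w)"
  by (simp add: linP_def poly_act_mult poly_act_const)

lemma linP_dP: "skew_pair w g c \<Longrightarrow> linP (dP w g)"
  by (simp add: linP_def app_dP ddiff_scale)

lemma linP_one [simp]: "linP 1"
  by (simp add: linP_def)

lemma aP_mult: "w \<in> carrier B_group \<Longrightarrow> w' \<in> carrier B_group \<Longrightarrow> aP w * aP w' = aP (w \<otimes>\<^bsub>B_group\<^esub> w')"
  by (rule endo_eqI) (simp add: poly_act_comp)

lemma aP_one: "aP \<one>\<^bsub>B_group\<^esub> = 1"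
  by (rule endo_eqI) (simp add: poly_act_id)

lemma aP_xP: "w \<in> carrier B_group \<Longrightarrow> aP w * xP i = sg (snd w i) (xP (fst w i)) * aP w"
  using sign_cases[of w i]
  by (intro endo_eqI) (auto simp: poly_act_mult poly_act_pvar signed_act_def)

lemma xP_comm: "xP i * xP j = xP j * xP i"
  by (rule endo_eqI) (simp add: mult_ac)

abbreviation "Ds i k \<equiv> dP (s_refl k i) (pvar i - pvar k)"
abbreviation "Db i k \<equiv> dP (sbar_refl k i) (pvar i + pvar k)"
abbreviation "Dt i \<equiv> dP (tau_refl i) (2 * pvar i)"

lemma D_xP:
  "i \<noteq> k \<Longrightarrow> Ds i k * xP j = xP j * Ds i k +
     (if j = i then aP (s_refl k i) else if j = k then - aP (s_refl k i) else 0)"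
  "i \<noteq> k \<Longrightarrow> Db i k * xP j = xP j * Db i k + (if j = i \<or> j = k then aP (sbar_refl k i) else 0)"
  "Dt i * xP j = xP j * Dt i + (if j = i then aP (tau_refl i) else 0)"
  by (rule endo_eqI; simp add: app_dP[OF skew_pairs(1)] app_dP[OF skew_pairs(2)] app_dP[OF skew_pair_tau]
      ddiff_pvar[OF skew_pairs(1)] ddiff_pvar[OF skew_pairs(2)] ddiff_pvar[OF skew_pair_tau])+

section \<open>A \<open>K\<close>-module as operators satisfying the relations of
  \<open>K\<close>\<close>

locale K_module =
  fixes \<rho> :: "'n::{finite,linorder} gen falg set \<Rightarrow> 'm::ab_group_add \<Rightarrow> 'm"
  assumes K_module: "left_module K_alg \<rho>"
begin

definition kM :: "'n gen falg \<Rightarrow> 'm endo" where "kM a = Endo (\<rho> (K_cls a))"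

lemma app_kM: "a \<in> fcar K_gens \<Longrightarrow> app (kM a) m = \<rho> (K_cls a) m"
  using K_module by (simp add: kM_def app_Endo left_module_def K_cls_simps)

lemma kM_add: "a \<in> fcar K_gens \<Longrightarrow> b \<in> fcar K_gens \<Longrightarrow> kM (a + b) = kM a + kM b"
  using K_module by (intro endo_eqI) (simp add: app_kM left_module_def K_cls_simps flip: K_cls_simps(2))

lemma kM_mult: "a \<in> fcar K_gens \<Longrightarrow> b \<in> fcar K_gens \<Longrightarrow> kM (a * b) = kM a * kM b"
  using K_module by (intro endo_eqI) (simp add: app_kM left_module_def K_cls_simps flip: K_cls_simps(3))

lemma kM_one: "kM 1 = 1"
  using K_module by (intro endo_eqI) (simp add: app_kM left_module_def flip: K_cls_simps(4))

lemma kM_zero: "kM 0 = 0"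
  using kM_add[of 0 0] by simp

lemma kM_uminus: "a \<in> fcar K_gens \<Longrightarrow> kM (- a) = - kM a"
  using kM_add[of a "- a"] by (simp add: kM_zero eq_neg_iff_add_eq_0 add.commute)

lemma kM_diff: "a \<in> fcar K_gens \<Longrightarrow> b \<in> fcar K_gens \<Longrightarrow> kM (a - b) = kM a - kM b"
  using kM_add[of a "- b"] by (simp add: kM_uminus)

lemma kM_rel: "r \<in> K_rels \<Longrightarrow> kM r = 0"
  using K.cls_rel[of r 0] K_rels_fcar kM_zero by (auto simp: kM_def K_cls_def)

definition "sM z = kM (fscal z)"
definition "cM i = kM (cg i)"
text \<open>The default 0 off the group makes \<open>wM w\<close> commute with scalars for every
  pair \<open>w\<close>. Evaluation of the free algebra assigns a value to every letter
  \<open>GW w\<close>, including pairs that are no signed permutations.\<close>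

definition "wM w = (if w \<in> carrier B_group then kM (wg w) else 0)"

lemma sM_add: "sM (y + z) = sM y + sM z" and sM_mult: "sM (y * z) = sM y * sM z"
  and sM_one [simp]: "sM 1 = 1" and sM_zero [simp]: "sM 0 = 0"
  by (simp_all add: sM_def fscal_add fscal_mult kM_add kM_mult kM_one kM_zero)

lemma sM_kM: "a \<in> fcar K_gens \<Longrightarrow> sM z * kM a = kM a * sM z"
  by (simp add: sM_def kM_mult[symmetric] fscal_commute)

lemma cM_sq: "cM i * cM i = 1"
proof -
  have "kM (cg i * cg i - 1) = 0" by (rule kM_rel) (auto simp: K_rels_def)
  then show ?thesis by (simp add: kM_diff kM_mult kM_one cM_def)
qed

lemma cM_anti: "i \<noteq> j \<Longrightarrow> cM i * cM j = - (cM j * cM i)"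
proof -
  assume "i \<noteq> j"
  then have "kM (cg i * cg j + cg j * cg i) = 0" by (intro kM_rel) (auto simp: K_rels_def)
  then show ?thesis by (simp add: kM_add kM_mult cM_def eq_neg_iff_add_eq_0)
qed

lemma wM_one: "wM \<one>\<^bsub>B_group\<^esub> = 1"
proof -
  have "kM (wg \<one>\<^bsub>B_group\<^esub> - 1) = 0" by (intro kM_rel) (auto simp: K_rels_def)
  then show ?thesis by (simp add: kM_diff kM_one wM_def)
qed

lemma wM_mult: "w \<in> carrier B_group \<Longrightarrow> w' \<in> carrier B_group \<Longrightarrow> wM w * wM w' = wM (w \<otimes>\<^bsub>B_group\<^esub> w')"
proof -
  assume w: "w \<in> carrier B_group" "w' \<in> carrier B_group"
  then have "kM (wg w * wg w' - wg (w \<otimes>\<^bsub>B_group\<^esub> w')) = 0"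
    by (intro kM_rel) (unfold K_rels_def, blast)
  with w show ?thesis by (simp add: kM_diff kM_mult wM_def)
qed

lemma wM_cM: "w \<in> carrier B_group \<Longrightarrow> wM w * cM i = sg (snd w i) (cM (fst w i)) * wM w"
proof -
  assume w: "w \<in> carrier B_group"
  then have "kM (wg w * cg i * wg (inv\<^bsub>B_group\<^esub> w) - signed_act w cg i) = 0"
    by (intro kM_rel) (unfold K_rels_def, blast)
  moreover have "kM (signed_act w cg i) = sg (snd w i) (cM (fst w i))"
    using sign_cases[OF w, of i] by (auto simp: signed_act_def cM_def kM_uminus)
  ultimately have "wM w * cM i * wM (inv\<^bsub>B_group\<^esub> w) = sg (snd w i) (cM (fst w i))"
    using w by (simp add: kM_diff kM_mult wM_def cM_def signed_act_fcar)
  then have "wM w * cM i * (wM (inv\<^bsub>B_group\<^esub> w) * wM w) = sg (snd w i) (cM (fst w i)) * wM w"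
    by (simp add: mult.assoc[symmetric])
  then show ?thesis using w by (simp add: wM_mult wM_one)
qed

section \<open>Tensor operators on polynomials with coefficients in \<open>M\<close>\<close>

definition linM :: "'m endo \<Rightarrow> bool" where "linM L \<longleftrightarrow> (\<forall>z. sM z * L = L * sM z)"

lemma linM_simps [simp]: "linM 1" "linM (cM i)" "linM (wM w)" "linM (sM z)"
  by (auto simp: linM_def cM_def wM_def sM_kM simp flip: sM_mult) (simp add: mult.commute)

lemma linM_mult [simp]: "linM a \<Longrightarrow> linM b \<Longrightarrow> linM (a * b)"
  unfolding linM_def by (metis mult.assoc)

lemma lookup_ptensor: "Poly_Mapping.lookup (ptensor \<rho> f m) a = app (sM (Poly_Mapping.lookup f a)) m"
  using endo_apps(1)[of m] sM_zero app_kM[of "fscal 0" m]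
  by (auto simp: ptensor_def Poly_Mapping.map.rep_eq when_def sM_def app_kM)

lemma ptensor_add_left: "ptensor \<rho> (f + g) m = ptensor \<rho> f m + ptensor \<rho> g m"
  and ptensor_add_right: "ptensor \<rho> f (m + m') = ptensor \<rho> f m + ptensor \<rho> f m'"
  by (rule poly_mapping_eqI, simp add: lookup_ptensor lookup_add sM_add)+

lemma ptensor_zero [simp]: "ptensor \<rho> 0 m = 0" "ptensor \<rho> f 0 = 0"
  by (rule poly_mapping_eqI, simp add: lookup_ptensor)+

lemma ptensor_minus: "ptensor \<rho> (- f) m = - ptensor \<rho> f m" "ptensor \<rho> f (- m) = - ptensor \<rho> f m"
  using ptensor_add_left[of f "- f" m] ptensor_add_right[of f m "- m"]
  by (simp_all add: eq_neg_iff_add_eq_0 add.commute)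

lemma ptensor_single: "ptensor \<rho> (Poly_Mapping.single a z) m = Poly_Mapping.single a (app (sM z) m)"
  by (rule poly_mapping_eqI) (auto simp: lookup_ptensor lookup_single when_def)

lemma ptensor_scale: "ptensor \<rho> (Poly_Mapping.single 0 z * f) m = ptensor \<rho> f (app (sM z) m)"
proof (rule poly_mapping_eqI)
  fix a
  have "Poly_Mapping.lookup (Poly_Mapping.single 0 z * f) a = Poly_Mapping.lookup f a * z"
    by (simp add: mult_map_scale_conv_mult[symmetric] Poly_Mapping.map.rep_eq when_def)
  then show "Poly_Mapping.lookup (ptensor \<rho> (Poly_Mapping.single 0 z * f) m) a =
      Poly_Mapping.lookup (ptensor \<rho> f (app (sM z) m)) a"
    by (simp add: lookup_ptensor sM_mult)
qed

text \<open>Given by its values on monomials with a coefficient. In general this is just an additive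
  map; under \<open>linP\<close> and \<open>linM\<close> it is the tensor product of the two
  operators.\<close>

definition tens :: "'n cpoly endo \<Rightarrow> 'm endo \<Rightarrow> (('n \<Rightarrow>\<^sub>0 nat) \<Rightarrow>\<^sub>0 'm) endo" where
  "tens T L = Endo (\<lambda>t. \<Sum>a\<in>Poly_Mapping.keys t.
     ptensor \<rho> (app T (Poly_Mapping.single a 1)) (app L (Poly_Mapping.lookup t a)))"

lemma app_tens: "app (tens T L) t = (\<Sum>a\<in>Poly_Mapping.keys t.
     ptensor \<rho> (app T (Poly_Mapping.single a 1)) (app L (Poly_Mapping.lookup t a)))"
  unfolding tens_def by (subst app_Endo) (auto intro!: sum_keys_add simp: ptensor_add_right)

lemma tens_single: "app (tens T L) (Poly_Mapping.single a m) = ptensor \<rho> (app T (Poly_Mapping.single a 1)) (app L m)"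
  by (cases "m = 0") (auto simp: app_tens)

text \<open>A coefficient of \<open>f\<close> is moved into the module, passed through
  \<open>L\<close>, and moved back through \<open>T\<close>; this is where both linearities
  enter.\<close>

lemma tens_ptensor:
  assumes T: "linP T" and L: "linM L"
  shows "app (tens T L) (ptensor \<rho> f m) = ptensor \<rho> (app T f) (app L m)"
proof (rule additive_poly_mapping_eqI[of "\<lambda>f. app (tens T L) (ptensor \<rho> f m)"])
  fix a :: "'n \<Rightarrow>\<^sub>0 nat" and z
  have "app L (app (sM z) m) = app (sM z) (app L m)"
    using L unfolding linM_def by (metis endo_apps(6))
  moreover have "Poly_Mapping.single a z = Poly_Mapping.single 0 z * Poly_Mapping.single a 1"
    by (simp add: mult_single)
  ultimately show "app (tens T L) (ptensor \<rho> (Poly_Mapping.single a z) m) =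
      ptensor \<rho> (app T (Poly_Mapping.single a z)) (app L m)"
    using T by (simp add: ptensor_single tens_single ptensor_scale linP_def)
qed (simp_all add: ptensor_add_left)

lemma tens_mult: "linP T \<Longrightarrow> linM L \<Longrightarrow> tens T L * tens T' L' = tens (T * T') (L * L')"
  by (rule endo_poly_mapping_eqI) (simp add: tens_single tens_ptensor)

lemma tens_add: "tens (T + T') L = tens T L + tens T' L" "tens T (L + L') = tens T L + tens T L'"
  and tens_minus: "tens (- T) L = - tens T L" "tens T (- L) = - tens T L"
  and tens_zero: "tens 0 L = 0" "tens T 0 = 0"
  by (rule endo_poly_mapping_eqI; simp add: tens_single ptensor_add_left ptensor_add_right ptensor_minus
       diff_conv_add_uminus del: add_uminus_conv_diff)+

lemma tens_one: "tens 1 1 = 1"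
  by (rule endo_poly_mapping_eqI) (simp add: tens_single ptensor_single)

definition "xV j = tens (xP j) 1"
definition "cV j = tens (aP (tau_refl j)) (cM j)"
definition "wV w = tens (aP w) (wM w)"
definition "sV z = tens 1 (sM z)"
text \<open>The Clifford factors sit on the module side, since (p c_k c_i) \<otimes> s m means p
  \<otimes> c_k c_i s m. Writing everything with \<open>tens\<close> lets products be computed
  factor by factor.\<close>

definition "yV u v i =
    - (sV u * (\<Sum>k\<in>UNIV - {i}. tens (Ds i k) (wM (s_refl k i)) + tens (Db i k) (cM k * cM i * wM (s_refl k i))))
    - sV u * (\<Sum>k\<in>UNIV - {i}. tens (Db i k) (wM (sbar_refl k i)) - tens (Ds i k) (cM k * cM i * wM (sbar_refl k i)))
    - sV (of_real (sqrt 2) * v) * tens (Dt i) (wM (tau_refl i))"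

lemma xV_single: "app (xV j) (Poly_Mapping.single a m) = Poly_Mapping.single (Poly_Mapping.single j 1 + a) m"
  by (simp add: xV_def tens_single ptensor_single single_eq_pvar_mult[symmetric] del: One_nat_def)

lemma xV_xV: "xV i * xV j = xV j * xV i"
  by (simp add: xV_def tens_mult xP_comm)

lemma sV_comm: "linP T \<Longrightarrow> linM L \<Longrightarrow> sV z * tens T L = tens T L * sV z"
  by (simp add: sV_def tens_mult) (simp add: linM_def)

lemma sV_add: "sV (y + z) = sV y + sV z" and sV_mult: "sV (y * z) = sV y * sV z"
  and sV_one: "sV 1 = 1"
  by (simp_all add: sV_def sM_add sM_mult tens_add tens_mult tens_one)

lemma wV_wV: "w \<in> carrier B_group \<Longrightarrow> w' \<in> carrier B_group \<Longrightarrow> wV w * wV w' = wV (w \<otimes>\<^bsub>B_group\<^esub> w')"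
  by (simp add: wV_def tens_mult aP_mult wM_mult)

lemma wV_one: "wV \<one>\<^bsub>B_group\<^esub> = 1"
  by (simp add: wV_def aP_one wM_one tens_one)

lemma cV_sq: "cV i * cV i = 1"
  by (simp add: cV_def tens_mult aP_mult cM_sq aP_one tens_one)

lemma cV_anti: "i \<noteq> j \<Longrightarrow> cV i * cV j = - (cV j * cV i)"
  using cM_anti[of i j] conj_refl(3)[of "tau_refl i" j]
  by (simp add: cV_def tens_mult aP_mult tens_minus)

lemma wV_cV: "w \<in> carrier B_group \<Longrightarrow> wV w * cV i = sg (snd w i) (cV (fst w i)) * wV w"
  using wM_cM[of w i] conj_refl(3)[of w i] sign_cases[of w i]
  by (auto simp: cV_def wV_def tens_mult aP_mult tens_minus)

lemma cV_xV: "cV j * xV k = (if j = k then - (xV k * cV j) else xV k * cV j)"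
  by (simp add: cV_def xV_def tens_mult aP_xP tens_minus)

lemma wV_xV: "w \<in> carrier B_group \<Longrightarrow> wV w * xV i = sg (snd w i) (xV (fst w i)) * wV w"
  using sign_cases[of w i]
  by (auto simp: wV_def xV_def tens_mult aP_xP tens_minus)

definition linV :: "(('n \<Rightarrow>\<^sub>0 nat) \<Rightarrow>\<^sub>0 'm) endo \<Rightarrow> bool" where "linV A \<longleftrightarrow> (\<forall>z. sV z * A = A * sV z)"

lemma linV_intros:
  "linP T \<Longrightarrow> linM L \<Longrightarrow> linV (tens T L)" "linV (sV z)" "linV 0"
  "linV A \<Longrightarrow> linV (- A)"
  "linV A \<Longrightarrow> linV B \<Longrightarrow> linV (A + B)" "linV A \<Longrightarrow> linV B \<Longrightarrow> linV (A - B)"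
  "linV A \<Longrightarrow> linV B \<Longrightarrow> linV (A * B)"
proof -
  show "linV A \<Longrightarrow> linV B \<Longrightarrow> linV (A * B)" unfolding linV_def by (metis mult.assoc)
  show "linV (sV z)" by (simp add: linV_def sV_mult[symmetric] mult.commute)
qed (auto simp: linV_def sV_comm distrib_left distrib_right left_diff_distrib right_diff_distrib)

lemma linV_sum: "(\<And>k. k \<in> A \<Longrightarrow> linV (g k)) \<Longrightarrow> linV (sum g A)"
  by (induction A rule: infinite_finite_induct) (auto intro: linV_intros)

lemma linV_gens: "linV (xV j)" "linV (cV j)" "linV (wV w)" "linV (yV u v i)"
proof -
  show "linV (yV u v i)"
    unfolding yV_def
    by (intro linV_intros linV_sum linP_dP[OF skew_pairs(1)] linP_dP[OF skew_pairs(2)]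
        linP_dP[OF skew_pair_tau] linM_simps linM_mult) auto
qed (auto simp: xV_def cV_def wV_def intro!: linV_intros)

lemma yV_const: "app (yV u v i) (Poly_Mapping.single 0 m) = 0"
  by (simp add: yV_def app_sum_endo tens_single app_dP[OF skew_pairs(1)] app_dP[OF skew_pairs(2)] app_dP[OF skew_pair_tau]
      ddiff_const[OF skew_pairs(1)] ddiff_const[OF skew_pairs(2)] ddiff_const[OF skew_pair_tau]
     del: single_one cong: sum.cong_simp)

end

fun gen_act :: "('n \<Rightarrow> 'e) \<Rightarrow> ('n \<Rightarrow> 'e) \<Rightarrow> ('n \<Rightarrow> 'e) \<Rightarrow> ('n sperm \<Rightarrow> 'e) \<Rightarrow> 'n gen \<Rightarrow> 'e" where
  "gen_act x y c w (GX i) = x i"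
| "gen_act x y c w (GY i) = y i"
| "gen_act x y c w (GC i) = c i"
| "gen_act x y c w (GW g) = w g"

section \<open>Commutators of y_i and x_j on the polynomial space\<close>

context K_module
begin

lemma ptensor_one: "ptensor \<rho> 1 m = Poly_Mapping.single 0 m"
  using ptensor_single[of 0 1 m] by simp

lemma tens_D_xV:
  assumes "linM L"
  shows "i \<noteq> k \<Longrightarrow> tens (Ds i k) L * xV j = xV j * tens (Ds i k) L +
     (if j = i then tens (aP (s_refl k i)) L else if j = k then - tens (aP (s_refl k i)) L else 0)"
    and "i \<noteq> k \<Longrightarrow> tens (Db i k) L * xV j = xV j * tens (Db i k) L +
     (if j = i \<or> j = k then tens (aP (sbar_refl k i)) L else 0)"
    and "tens (Dt i) L * xV j = xV j * tens (Dt i) L + (if j = i then tens (aP (tau_refl i)) L else 0)"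
  using assms
  by (simp_all add: xV_def tens_mult linP_dP[OF skew_pairs(1)] linP_dP[OF skew_pairs(2)]
      linP_dP[OF skew_pair_tau] D_xP tens_add tens_minus tens_zero)

text \<open>The sign changes carried by \<open>cV k\<close> and \<open>cV i\<close> exchange s and
  sbar on the polynomial side and leave the module side alone. The Leibniz terms of the crossed
  divided differences are thereby recognised as operators coming from \<open>K\<close>.\<close>

lemma cV_cV_wV:
  assumes "i \<noteq> k"
  shows "cV k * cV i * wV (s_refl k i) = tens (aP (sbar_refl k i)) (cM k * cM i * wM (s_refl k i))"
    and "cV k * cV i * wV (sbar_refl k i) = tens (aP (s_refl k i)) (cM k * cM i * wM (sbar_refl k i))"
  using assms by (simp_all add: cV_def wV_def tens_mult aP_mult tau_tau_s mult.assoc B.m_assoc)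

text \<open>Each divided difference passes \<open>xV j\<close> up to one Leibniz term, nonzero only
  for j = i or j = k. The case distinction stays inside the sums so that both kinds of relations are
  read off from one identity.\<close>

lemma yV_xV:
  "yV u v i * xV j = xV j * yV u v i
    + (- (sV u * (\<Sum>k\<in>UNIV - {i}.
          if j = i then wV (s_refl k i) + cV k * cV i * wV (s_refl k i)
          else if j = k then - wV (s_refl k i) + cV k * cV i * wV (s_refl k i) else 0))
       - sV u * (\<Sum>k\<in>UNIV - {i}.
          if j = i then wV (sbar_refl k i) - cV k * cV i * wV (sbar_refl k i)
          else if j = k then wV (sbar_refl k i) + cV k * cV i * wV (sbar_refl k i) else 0)
       - sV (of_real (sqrt 2) * v) * (if j = i then wV (tau_refl i) else 0))"
proof -
  have sx: "sV z * xV j = xV j * sV z" for z j using linV_gens(1) by (simp add: linV_def)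
  have sum_comm: "sV z * sum g B * xV j = xV j * (sV z * sum g B) + sV z * sum g' B"
    if "\<And>k. k \<in> B \<Longrightarrow> g k * xV j = xV j * g k + g' k" for g g' z and B :: "'n set"
  proof -
    have "sum g B * xV j = xV j * sum g B + sum g' B"
      using that by (simp add: sum_distrib_left sum_distrib_right sum.distrib[symmetric])
    then show ?thesis by (simp add: mult.assoc distrib_left) (simp add: mult.assoc[symmetric] sx)
  qed
  have A: "(tens (Ds i k) (wM (s_refl k i)) + tens (Db i k) (cM k * cM i * wM (s_refl k i))) * xV j
    = xV j * (tens (Ds i k) (wM (s_refl k i)) + tens (Db i k) (cM k * cM i * wM (s_refl k i)))
    + (if j = i then wV (s_refl k i) + cV k * cV i * wV (s_refl k i)
       else if j = k then - wV (s_refl k i) + cV k * cV i * wV (s_refl k i) else 0)"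
    if "k \<in> UNIV - {i}" for k
    using that by (simp add: distrib_left distrib_right tens_D_xV cV_cV_wV add_ac flip: wV_def)
  have B: "(tens (Db i k) (wM (sbar_refl k i)) - tens (Ds i k) (cM k * cM i * wM (sbar_refl k i))) * xV j
    = xV j * (tens (Db i k) (wM (sbar_refl k i)) - tens (Ds i k) (cM k * cM i * wM (sbar_refl k i)))
    + (if j = i then wV (sbar_refl k i) - cV k * cV i * wV (sbar_refl k i)
       else if j = k then wV (sbar_refl k i) + cV k * cV i * wV (sbar_refl k i) else 0)"
    if "k \<in> UNIV - {i}" for k
    using that by (simp add: tens_D_xV cV_cV_wV[unfolded mult.assoc] algebra_simps flip: wV_def)
  have T: "sV z * tens (Dt i) (wM (tau_refl i)) * xV j = xV j * (sV z * tens (Dt i) (wM (tau_refl i)))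
     + sV z * (if j = i then wV (tau_refl i) else 0)" for z
    by (simp add: mult.assoc tens_D_xV wV_def distrib_left) (simp add: mult.assoc[symmetric] sx)
  have combine: "(- p - q - r) * x = x * (- p - q - r) + (- p' - q' - r')"
    if "p * x = x * p + p'" "q * x = x * q + q'" "r * x = x * r + r'"
    for p p' q q' r r' x :: "(('n \<Rightarrow>\<^sub>0 nat) \<Rightarrow>\<^sub>0 'm) endo"
    using that by (simp add: left_diff_distrib right_diff_distrib)
  show ?thesis
    unfolding yV_def by (rule combine[OF sum_comm[OF A] sum_comm[OF B] T])
qed

lemma cV_const: "app (cV j) (Poly_Mapping.single 0 m) = Poly_Mapping.single 0 (app (cM j) m)"
  and wV_const: "app (wV w) (Poly_Mapping.single 0 m) = Poly_Mapping.single 0 (app (wM w) m)"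
  and sV_const: "app (sV z) (Poly_Mapping.single 0 m) = Poly_Mapping.single 0 (app (sM z) m)"
  by (simp_all add: cV_def wV_def sV_def tens_single poly_act_one ptensor_one)

lemma dunkl_operators_V:
  "dunkl_operators sV xV (yV u v) cV wV u v {N. \<forall>m. app N (Poly_Mapping.single 0 m) = 0}"
proof
  show "sV z * cV i = cV i * sV z" "sV z * wV w = wV w * sV z" "sV z * yV u v i = yV u v i * sV z" for z i w
    using linV_gens by (auto simp: linV_def)
  show "yV u v i * xV k = xV k * yV u v i
      + sV u * ((1 + cV i * cV k) * wV (s_refl i k) - (1 - cV i * cV k) * wV (sbar_refl i k))"
    if "i \<noteq> k" for i k
  proof -
    have "(\<Sum>l\<in>UNIV - {i}. if k = i then f l else if k = l then g l else 0) = g k"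
      for f g :: "'n \<Rightarrow> (('n \<Rightarrow>\<^sub>0 nat) \<Rightarrow>\<^sub>0 'm) endo"
      using that by simp
    \<comment> \<open>Only one summand survives, and its products come out with the Clifford
      generators in the opposite order; anticommutation gives the signs of the relation.\<close>
    then show ?thesis
      using that cV_anti[OF that]
      by (simp add: yV_xV algebra_simps refl_commute[of i k])
  qed
  show "yV u v i * xV i = xV i * yV u v i +
      (- (sV u * (\<Sum>k\<in>UNIV - {i}. (1 + cV k * cV i) * wV (s_refl k i) + (1 - cV k * cV i) * wV (sbar_refl k i)))
       - sV (of_real (sqrt 2) * v) * wV (tau_refl i))" for i
    by (simp add: yV_xV algebra_simps sum.distrib sum_subtractf)
  \<comment> \<open>Constants are annihilated by assumption, and N x_j x^a m = Z N x^a m carries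
    this to all monomials; \<open>Z\<close> may depend on the variable.\<close>
  show "N = 0" if N: "N \<in> {N. \<forall>m. app N (Poly_Mapping.single 0 m) = 0}" and Z: "\<And>k. \<exists>Z. N * xV k = Z * N"
    for N :: "(('n \<Rightarrow>\<^sub>0 nat) \<Rightarrow>\<^sub>0 'm) endo"
  proof (rule endo_poly_mapping_eqI)
    fix a and m :: 'm
    show "app N (Poly_Mapping.single a m) = app 0 (Poly_Mapping.single a m)"
    proof (induction a rule: monomial_induct)
      case (step a j)
      obtain Z where "N * xV j = Z * N" using Z by blast
      then have "app N (app (xV j) (Poly_Mapping.single a m)) = app Z (app N (Poly_Mapping.single a m))"
        by (metis endo_apps(6))
      with step show ?case by (simp add: xV_single)
    qed (use N in simp)
  qed
qed (simp_all add: cV_sq wV_wV wV_cV cV_xV wV_xV yV_const cV_const wV_const, (rule cV_anti, assumption)?)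

section \<open>The representation of the presented algebra\<close>

definition "genV u v = gen_act xV (yV u v) cV wV"
abbreviation "evV u v \<equiv> falg_eval sV (genV u v)"

lemma genV_simps [simp]:
  "genV u v (GX i) = xV i" "genV u v (GY i) = yV u v i" "genV u v (GC i) = cV i" "genV u v (GW w) = wV w"
  by (simp_all add: genV_def)

lemma alg_rep_V: "alg_rep sV (genV u v)"
proof
  show "sV z * genV u v g = genV u v g * sV z" for z g
    using linV_gens by (cases g) (auto simp: linV_def)
qed (simp_all add: sV_add sV_mult sV_one)

lemmas evV_simps = alg_rep.ev_add[OF alg_rep_V] alg_rep.ev_diff[OF alg_rep_V] alg_rep.ev_minus[OF alg_rep_V]
  alg_rep.ev_mult[OF alg_rep_V] alg_rep.ev_one[OF alg_rep_V] alg_rep.ev_zero[OF alg_rep_V]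
  alg_rep.ev_fscal[OF alg_rep_V] alg_rep.ev_fgen[OF alg_rep_V] alg_rep.ev_sum[OF alg_rep_V]

lemma evV_signed: "w \<in> carrier B_group \<Longrightarrow>
    evV u v (signed_act w (\<lambda>i. fgen (g i)) i) = sg (snd w i) (genV u v (g (fst w i)))"
  using sign_cases[of w i] by (auto simp: signed_act_def evV_simps)

lemma wV_conj:
  assumes w: "w \<in> carrier B_group" and a: "wV w * a = b * wV w"
  shows "wV w * a * wV (inv\<^bsub>B_group\<^esub> w) = b"
  using w by (simp add: a mult.assoc wV_wV wV_one)

lemma evV_K_rel: "r \<in> K_rels \<Longrightarrow> evV u v r = 0"
  unfolding K_rels_def
  by (elim UnE CollectE exE conjE; simp add: evV_simps evV_signed cV_sq wV_one wV_wV wV_conj[OF _ wV_cV])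
     (metis cV_anti add.left_inverse)

lemma evV_H_rel:
  assumes "r \<in> H_rels u v"
  shows "evV u v r = 0"
proof -
  interpret V: dunkl_operators sV xV "yV u v" cV wV u v "{N. \<forall>m. app N (Poly_Mapping.single 0 m) = 0}"
    by (rule dunkl_operators_V)
  \<comment> \<open>The presentation names the reflection by the index of x first and that of y
    second, the reverse of the order in \<open>V.YX_ne\<close>.\<close>
  have "yV u v i * xV j - xV j * yV u v i
      - sV u * ((1 + cV i * cV j) * wV (s_refl j i) - (1 - cV i * cV j) * wV (sbar_refl j i)) = 0"
    if "j \<noteq> i" for i j
    using V.YX_ne[of i j] that by (simp add: refl_commute[of i j])
  then show ?thesis
    using assms unfolding H_rels_def
    by (elim UnE CollectE exE conjE; simp add: evV_K_rel evV_simps evV_signed commutator_def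
      xV_xV V.YY V.YC cV_xV V.YX_eq wV_conj[OF _ wV_xV] wV_conj[OF _ V.WY])
qed

end

section \<open>Tensor products\<close>

text \<open>The map on representatives that underlies \<open>tensor_act\<close>.\<close>

definition pmul :: "('a, 'b) ring_scheme \<Rightarrow> 'a \<Rightarrow> ('a \<times> 'm \<Rightarrow>\<^sub>0 int) \<Rightarrow> ('a \<times> 'm \<Rightarrow>\<^sub>0 int)" where
  "pmul R h = frag_extend (\<lambda>(a, m). frag_of (h \<otimes>\<^bsub>R\<^esub> a, m))"

locale tensor_product =
  fixes R :: "('a, 'b) ring_scheme" and S :: "('a, 'c) ring_scheme"
    and \<rho> :: "'a \<Rightarrow> 'm::ab_group_add \<Rightarrow> 'm"
  assumes ring_R: "ring R" and sub: "carrier S \<subseteq> carrier R"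
begin

abbreviation "N \<equiv> tensor_ker R S \<rho>"
abbreviation "PG \<equiv> pairs_group R :: ('a \<times> 'm \<Rightarrow>\<^sub>0 int) monoid"

definition "tgens =
     ({frag_of (a \<oplus>\<^bsub>R\<^esub> b, m) - frag_of (a, m) - frag_of (b, m) | a b m.
         a \<in> carrier R \<and> b \<in> carrier R}
    \<union> {frag_of (a, m + m') - frag_of (a, m) - frag_of (a, m') | a m m'. a \<in> carrier R}
    \<union> {frag_of (a \<otimes>\<^bsub>R\<^esub> s, m) - frag_of (a, \<rho> s m) | a s m. a \<in> carrier R \<and> s \<in> carrier S})"

lemma N_def: "N = generate PG tgens"
  by (simp add: tensor_ker_def tgens_def)

lemma frag_of_carrier [simp]: "frag_of (a, m) \<in> carrier PG \<longleftrightarrow> a \<in> carrier R"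
  by (simp add: pairs_group_def)

lemma PG_closed:
  "z \<in> carrier PG \<Longrightarrow> z' \<in> carrier PG \<Longrightarrow> z + z' \<in> carrier PG"
  "z \<in> carrier PG \<Longrightarrow> z' \<in> carrier PG \<Longrightarrow> z - z' \<in> carrier PG"
  "z \<in> carrier PG \<Longrightarrow> - z \<in> carrier PG"
  "0 \<in> carrier PG"
  using Poly_Mapping.keys_add[of z z'] keys_diff[of z z'] by (auto simp: pairs_group_def)

lemma PG_simps: "x \<otimes>\<^bsub>PG\<^esub> y = x + y" "\<one>\<^bsub>PG\<^esub> = 0" "x \<in> carrier PG \<Longrightarrow> inv\<^bsub>PG\<^esub> x = - x"
  by (simp_all add: pairs_group_def)

lemma tgens_carrier: "tgens \<subseteq> carrier PG"
proof -
  interpret ring R by (rule ring_R)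
  show ?thesis using sub unfolding tgens_def
    by (auto intro!: PG_closed)
qed

lemma tgens_N: "z \<in> tgens \<Longrightarrow> z \<in> N"
  unfolding N_def by (rule generate.incl)

lemma N_zero: "0 \<in> N" and N_add: "z \<in> N \<Longrightarrow> z' \<in> N \<Longrightarrow> z + z' \<in> N"
  and N_minus: "z \<in> N \<Longrightarrow> - z \<in> N" and N_carrier: "z \<in> N \<Longrightarrow> z \<in> carrier PG"
proof -
  have "subgroup N PG"
    unfolding N_def using tgens_carrier by (intro group.generate_is_subgroup) (auto simp: pairs_group_def)
  then interpret subgroup N PG .
  show "0 \<in> N" using one_closed by (simp add: PG_simps)
  show "z \<in> N \<Longrightarrow> z' \<in> N \<Longrightarrow> z + z' \<in> N" using m_closed[of z z'] by (simp add: PG_simps)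
  show "z \<in> N \<Longrightarrow> z \<in> carrier PG" by simp
  then show "z \<in> N \<Longrightarrow> - z \<in> N" using m_inv_closed[of z] PG_simps(3)[of z] by simp
qed

lemma N_induct [consumes 1, case_names zero gen minus add]:
  assumes "z \<in> N" "P 0" "\<And>g. g \<in> tgens \<Longrightarrow> P g" "\<And>g. g \<in> tgens \<Longrightarrow> P (- g)"
    "\<And>x y. x \<in> N \<Longrightarrow> y \<in> N \<Longrightarrow> P x \<Longrightarrow> P y \<Longrightarrow> P (x + y)"
  shows "P z"
  using assms(1) unfolding N_def
proof (induction rule: generate.induct)
  case (inv h)
  then show ?case using assms(4)[of h] tgens_carrier PG_simps(3)[of h] by auto
qed (use assms in \<open>auto simp: PG_simps N_def\<close>)

definition teq (infix "\<asymp>" 50) where "z \<asymp> z' \<longleftrightarrow> z - z' \<in> N"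

lemma teq_refl [simp]: "z \<asymp> z"
  by (simp add: teq_def N_zero)

lemma teq_sym: "z \<asymp> z' \<Longrightarrow> z' \<asymp> z"
  using N_minus[of "z - z'"] by (simp add: teq_def)

lemma teq_trans [trans]: "z \<asymp> z' \<Longrightarrow> z' \<asymp> z'' \<Longrightarrow> z \<asymp> z''"
  using N_add[of "z - z'" "z' - z''"] by (simp add: teq_def)

lemma teq_add: "z \<asymp> z' \<Longrightarrow> y \<asymp> y' \<Longrightarrow> z + y \<asymp> z' + y'"
  using N_add[of "z - z'" "y - y'"] by (simp add: teq_def algebra_simps)

lemma teq_minus: "z \<asymp> z' \<Longrightarrow> - z \<asymp> - z'"
  using N_minus[of "z - z'"] by (simp add: teq_def algebra_simps)

lemma tensor_cls_eq_iff: "tensor_cls R S \<rho> z = tensor_cls R S \<rho> z' \<longleftrightarrow> z \<asymp> z'"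
proof -
  have cls: "tensor_cls R S \<rho> x = {n + x | n. n \<in> N}" for x
    by (auto simp: tensor_cls_def r_coset_def PG_simps)
  show ?thesis
  proof
    assume "tensor_cls R S \<rho> z = tensor_cls R S \<rho> z'"
    moreover have "z \<in> tensor_cls R S \<rho> z" unfolding cls using N_zero by force
    ultimately show "z \<asymp> z'" unfolding cls teq_def by auto
  next
    assume "z \<asymp> z'"
    then have d: "z - z' \<in> N" "z' - z \<in> N" using teq_sym by (auto simp: teq_def)
    show "tensor_cls R S \<rho> z = tensor_cls R S \<rho> z'"
    proof (unfold cls, intro equalityI subsetI; elim CollectE exE conjE)
      fix x n assume "x = n + z" "n \<in> N"
      then show "x \<in> {n + z' | n. n \<in> N}"
        using N_add[OF \<open>n \<in> N\<close> d(1)] by (intro CollectI exI[of _ "n + (z - z')"]) simp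
    next
      fix x n assume "x = n + z'" "n \<in> N"
      then show "x \<in> {n + z | n. n \<in> N}"
        using N_add[OF \<open>n \<in> N\<close> d(2)] by (intro CollectI exI[of _ "n + (z' - z)"]) simp
    qed
  qed
qed

lemma pmul_frag_of [simp]: "pmul R h (frag_of (a, m)) = frag_of (h \<otimes>\<^bsub>R\<^esub> a, m)"
  by (simp add: pmul_def)

lemma pmul_arith [simp]:
  "pmul R h 0 = 0" "pmul R h (z + z') = pmul R h z + pmul R h z'"
  "pmul R h (z - z') = pmul R h z - pmul R h z'" "pmul R h (- z) = - pmul R h z"
  by (simp_all add: pmul_def frag_extend_add frag_extend_diff frag_extend_minus)

lemma frag_add_left: "a \<in> carrier R \<Longrightarrow> b \<in> carrier R \<Longrightarrow>
    frag_of (a \<oplus>\<^bsub>R\<^esub> b, m) \<asymp> frag_of (a, m) + frag_of (b, m)"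
  unfolding teq_def diff_diff_eq[symmetric] by (rule tgens_N) (unfold tgens_def, blast)

lemma frag_add_right: "a \<in> carrier R \<Longrightarrow> frag_of (a, m + m') \<asymp> frag_of (a, m) + frag_of (a, m')"
  unfolding teq_def diff_diff_eq[symmetric] by (rule tgens_N) (unfold tgens_def, blast)

lemma frag_balanced: "a \<in> carrier R \<Longrightarrow> s \<in> carrier S \<Longrightarrow>
    frag_of (a \<otimes>\<^bsub>R\<^esub> s, m) \<asymp> frag_of (a, \<rho> s m)"
  unfolding teq_def by (rule tgens_N) (unfold tgens_def, blast)

lemma frag_zero_right: "a \<in> carrier R \<Longrightarrow> frag_of (a, 0) \<asymp> 0"
  using frag_add_right[of a 0 0] N_minus[of "- frag_of (a, 0)"] by (simp add: teq_def)

text \<open>Each of the three kinds of defining elements is sent to one of the same kind, by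
  distributivity for sums in the ring and by associativity for the balancing relation.\<close>

lemma pmul_N:
  assumes h: "h \<in> carrier R" and z: "z \<in> N"
  shows "pmul R h z \<in> N"
proof -
  interpret ring R by (rule ring_R)
  have gen: "pmul R h g \<in> N" if "g \<in> tgens" for g
    using that unfolding tgens_def
  proof (elim UnE CollectE exE conjE)
    fix a b m
    assume "g = frag_of (a \<oplus>\<^bsub>R\<^esub> b, m) - frag_of (a, m) - frag_of (b, m)" "a \<in> carrier R" "b \<in> carrier R"
    then show ?thesis
      using frag_add_left[of "h \<otimes>\<^bsub>R\<^esub> a" "h \<otimes>\<^bsub>R\<^esub> b" m] h
      by (simp add: r_distr teq_def diff_diff_eq)
  next
    fix a m m'
    assume "g = frag_of (a, m + m') - frag_of (a, m) - frag_of (a, m')" "a \<in> carrier R"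
    then show ?thesis
      using frag_add_right[of "h \<otimes>\<^bsub>R\<^esub> a" m m'] h by (simp add: teq_def diff_diff_eq)
  next
    fix a s m
    assume "g = frag_of (a \<otimes>\<^bsub>R\<^esub> s, m) - frag_of (a, \<rho> s m)" "a \<in> carrier R" "s \<in> carrier S"
    moreover from this have "s \<in> carrier R" using sub by blast
    ultimately show ?thesis
      using frag_balanced[of "h \<otimes>\<^bsub>R\<^esub> a" s m] h by (simp add: teq_def m_assoc)
  qed
  show ?thesis using z
    by (induction rule: N_induct) (auto simp: N_zero N_add N_minus gen)
qed

lemma pmul_cong: "h \<in> carrier R \<Longrightarrow> z \<asymp> z' \<Longrightarrow> pmul R h z \<asymp> pmul R h z'"
  using pmul_N[of h "z - z'"] by (simp add: teq_def)

text \<open>\<open>tensor_act\<close> takes the only element of the image of a whole coset. All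
  representatives give the same class because multiplication preserves the kernel.\<close>

lemma tensor_act_cls:
  assumes "h \<in> carrier R"
  shows "tensor_act R S \<rho> h (tensor_cls R S \<rho> z) = tensor_cls R S \<rho> (pmul R h z)"
proof -
  have mem: "x \<in> tensor_cls R S \<rho> z \<longleftrightarrow> x \<asymp> z" for x
  proof
    show "x \<asymp> z" if "x \<in> tensor_cls R S \<rho> z"
      using that by (auto simp: tensor_cls_def r_coset_def PG_simps teq_def)
    show "x \<in> tensor_cls R S \<rho> z" if "x \<asymp> z"
      using that by (auto simp: tensor_cls_def r_coset_def PG_simps teq_def intro!: bexI[of _ "x - z"])
  qed
  have "(\<lambda>x. tensor_cls R S \<rho> (pmul R h x)) ` tensor_cls R S \<rho> z = {tensor_cls R S \<rho> (pmul R h z)}"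
  proof (intro equalityI subsetI)
    fix T assume "T \<in> (\<lambda>x. tensor_cls R S \<rho> (pmul R h x)) ` tensor_cls R S \<rho> z"
    then obtain x where "T = tensor_cls R S \<rho> (pmul R h x)" "x \<in> tensor_cls R S \<rho> z" by blast
    then show "T \<in> {tensor_cls R S \<rho> (pmul R h z)}"
      using pmul_cong[OF assms] by (simp add: mem tensor_cls_eq_iff)
  next
    fix T assume "T \<in> {tensor_cls R S \<rho> (pmul R h z)}"
    then show "T \<in> (\<lambda>x. tensor_cls R S \<rho> (pmul R h x)) ` tensor_cls R S \<rho> z"
      using mem[of z] by auto
  qed
  then show ?thesis by (simp add: tensor_act_def pmul_def)
qed

lemma PG_induct [consumes 1, case_names gen diff]:
  assumes "z \<in> carrier PG" "\<And>a m. a \<in> carrier R \<Longrightarrow> P (frag_of (a, m))"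
    "\<And>x y. P x \<Longrightarrow> P y \<Longrightarrow> P (x - y)" "P 0"
  shows "P z"
  using assms(1) unfolding pairs_group_def carrier_free_Abelian_group_iff
  by (rule free_Abelian_group_induct) (use assms(2-) in auto)

text \<open>In general this is just a congruence: a pair whose first entry is a sum is a single
  generator of the free abelian group. Products, by contrast, act with equality in
  \<open>pmul_mult\<close>.\<close>

lemma pmul_add: "h \<in> carrier R \<Longrightarrow> h' \<in> carrier R \<Longrightarrow> z \<in> carrier PG \<Longrightarrow>
    pmul R (h \<oplus>\<^bsub>R\<^esub> h') z \<asymp> pmul R h z + pmul R h' z"
proof -
  interpret ring R by (rule ring_R)
  assume h: "h \<in> carrier R" "h' \<in> carrier R" and "z \<in> carrier PG"
  from this(3) show ?thesis
  proof (induction z rule: PG_induct)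
    case (gen a m)
    then show ?case using h frag_add_left[of "h \<otimes>\<^bsub>R\<^esub> a" "h' \<otimes>\<^bsub>R\<^esub> a"] by (simp add: l_distr)
  next
    case (diff x y)
    then show ?case using teq_add[OF diff(1) teq_minus[OF diff(2)]] by (simp add: algebra_simps)
  qed simp
qed

lemma pmul_mult: "h \<in> carrier R \<Longrightarrow> h' \<in> carrier R \<Longrightarrow> z \<in> carrier PG \<Longrightarrow>
    pmul R (h \<otimes>\<^bsub>R\<^esub> h') z = pmul R h (pmul R h' z)"
proof -
  interpret ring R by (rule ring_R)
  assume h: "h \<in> carrier R" "h' \<in> carrier R" and "z \<in> carrier PG"
  from this(3) show ?thesis
    by (induction z rule: PG_induct) (use h in \<open>simp_all add: m_assoc\<close>)
qed

text \<open>A biadditive balanced map extends from pairs to the free abelian group and vanishes on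
  the generators of the kernel. It is given on representatives, so its compatibility with the
  congruence is part of the conclusion.\<close>

lemma universal:
  fixes f :: "'a \<Rightarrow> 'm \<Rightarrow> 'v::ab_group_add"
  assumes "\<And>a b m. a \<in> carrier R \<Longrightarrow> b \<in> carrier R \<Longrightarrow> f (a \<oplus>\<^bsub>R\<^esub> b) m = f a m + f b m"
    and "\<And>a m m'. a \<in> carrier R \<Longrightarrow> f a (m + m') = f a m + f a m'"
    and "\<And>a s m. a \<in> carrier R \<Longrightarrow> s \<in> carrier S \<Longrightarrow> f (a \<otimes>\<^bsub>R\<^esub> s) m = f a (\<rho> s m)"
  obtains \<psi> where "\<And>a m. a \<in> carrier R \<Longrightarrow> \<psi> (frag_of (a, m)) = f a m"
    "\<And>z z'. z \<in> carrier PG \<Longrightarrow> z' \<in> carrier PG \<Longrightarrow> \<psi> (z + z') = \<psi> z + \<psi> z'"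
    "\<And>z z'. z \<in> carrier PG \<Longrightarrow> z' \<in> carrier PG \<Longrightarrow> z \<asymp> z' \<Longrightarrow> \<psi> z = \<psi> z'"
proof -
  interpret ring R by (rule ring_R)
  let ?V = "\<lparr>carrier = UNIV, monoid.mult = (+), one = 0\<rparr> :: 'v monoid"
  interpret V: comm_group ?V
    by (rule comm_groupI) (auto simp: add_ac intro: exI[of _ "- x" for x])
  obtain \<psi> where hom: "\<psi> \<in> hom PG ?V"
    and \<psi>: "\<And>x. x \<in> carrier R \<times> UNIV \<Longrightarrow> \<psi> (frag_of x) = (case x of (a, m) \<Rightarrow> f a m)"
    unfolding pairs_group_def
    by (rule V.free_Abelian_group_universal[of "\<lambda>(a, m). f a m" "carrier R \<times> UNIV"]) auto
  have add: "\<psi> (z + z') = \<psi> z + \<psi> z'" if "z \<in> carrier PG" "z' \<in> carrier PG" for z z'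
    using hom_mult[OF hom that] by (simp add: PG_simps)
  have zero: "\<psi> 0 = 0" using add[of 0 0] PG_closed(4) by simp
  have minus: "\<psi> (- z) = - \<psi> z" if "z \<in> carrier PG" for z
    using add[of z "- z"] that PG_closed(3)[of z] zero by (simp add: eq_neg_iff_add_eq_0 add.commute)
  have diff: "\<psi> (z - z') = \<psi> z - \<psi> z'" if "z \<in> carrier PG" "z' \<in> carrier PG" for z z'
    using add[of z "- z'"] that minus PG_closed(3)[of z'] by simp
  have fr: "\<psi> (frag_of (a, m)) = f a m" if "a \<in> carrier R" for a m
    using \<psi>[of "(a, m)"] that by simp
  have gen: "\<psi> g = 0" if "g \<in> tgens" for g
    using that sub unfolding tgens_def by (auto simp: diff fr PG_closed assms)
  have N: "\<psi> z = 0" if "z \<in> N" for z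
    using that by (induction rule: N_induct) (use gen tgens_carrier in \<open>auto simp: zero minus add N_carrier\<close>)
  show ?thesis
  proof (rule that[of \<psi>])
    fix z z' assume z: "z \<in> carrier PG" "z' \<in> carrier PG" "z \<asymp> z'"
    then have "\<psi> (z - z') = 0" by (intro N) (simp add: teq_def)
    then show "\<psi> z = \<psi> z'" using z by (simp add: diff)
  qed (auto simp: fr add)
qed

end

section \<open>The extension by zero\<close>

lemma Hy_simps:
  "\<one>\<^bsub>Hy_alg u v\<^esub> = \<one>\<^bsub>H_alg u v\<^esub>" "x \<otimes>\<^bsub>Hy_alg u v\<^esub> y = x \<otimes>\<^bsub>H_alg u v\<^esub> y"
  "x \<oplus>\<^bsub>Hy_alg u v\<^esub> y = x \<oplus>\<^bsub>H_alg u v\<^esub> y"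
  "carrier (Hy_alg u v) = generate_ring (H_alg u v)
      (H_cls u v ` fcar K_gens \<union> range (\<lambda>i. H_cls u v (yg i)))"
  by (simp_all add: Hy_alg_def)

lemma ring_H: "ring (H_alg u v)"
  using H.ring_pres by (simp add: H_alg_def)

lemma carrier_H: "carrier (H_alg u v) = H_cls u v ` fcar H_gens"
  using H.carrier_pres by (simp add: H_alg_def H_cls_def)

lemma Hy_subset: "carrier (Hy_alg u v) \<subseteq> carrier (H_alg u v)"
  unfolding Hy_simps using K_subset_H
  by (intro ring.generate_ring_incl[OF ring_H]) (auto simp: carrier_H)

lemmas generated_in_H = subsetD[OF Hy_subset, unfolded Hy_simps]

text \<open>\<open>generate_ring\<close> has a clause for additive inverses while
  \<open>left_module\<close> has none, so the rule is derived from additivity.\<close>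

lemma left_module_uminus:
  assumes "left_module (Hy_alg u v) \<rho>'" "h \<in> carrier (Hy_alg u v)"
  shows "\<rho>' (\<ominus>\<^bsub>H_alg u v\<^esub> h) m = - \<rho>' h m"
proof -
  interpret ring "H_alg u v" by (rule ring_H)
  have m: "\<ominus>\<^bsub>H_alg u v\<^esub> h \<in> carrier (Hy_alg u v)" "\<zero>\<^bsub>H_alg u v\<^esub> \<in> carrier (Hy_alg u v)"
    using assms(2) zero_in_generate by (auto simp: Hy_simps intro: generate_ring.a_inv)
  have add: "\<rho>' (x \<oplus>\<^bsub>H_alg u v\<^esub> y) m = \<rho>' x m + \<rho>' y m"
    if "x \<in> carrier (Hy_alg u v)" "y \<in> carrier (Hy_alg u v)" for x y
    using assms(1) that by (simp add: left_module_def Hy_simps(1-3))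
  have "\<rho>' \<zero>\<^bsub>H_alg u v\<^esub> m = 0" using add[OF m(2) m(2)] by simp
  moreover have "h \<in> carrier (H_alg u v)" using assms(2) Hy_subset by blast
  ultimately show ?thesis
    using add[OF m(1) assms(2)] by (simp add: l_neg eq_neg_iff_add_eq_0)
qed

context K_module
begin

text \<open>Sign changes and permutations fix the constant polynomial 1, so elements of
  \<open>K\<close> act on the coefficient alone.\<close>

lemma evV_K:
  assumes "a \<in> fcar K_gens"
  shows "app (evV u v a) (Poly_Mapping.single 0 m) = Poly_Mapping.single 0 (\<rho> (K_cls a) m)"
proof -
  have "app (evV u v a) (Poly_Mapping.single 0 m) = Poly_Mapping.single 0 (app (kM a) m)"
    using assms
  proof (induction arbitrary: m rule: fcar_induct)
    case (gen g)
    then show ?case by (cases g) (auto simp: evV_simps cV_const wV_const cM_def wM_def)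
  qed (simp_all add: evV_simps sV_const sM_def kM_add kM_mult single_add)
  then show ?thesis by (simp add: app_kM assms)
qed

text \<open>The choice of representative is harmless because all relations evaluate to zero;
  \<open>hact_cls\<close> records this.\<close>

definition "hact u v h = evV u v (SOME a. a \<in> fcar H_gens \<and> H_cls u v a = h)"

lemma hact_cls:
  assumes "a \<in> fcar H_gens"
  shows "hact u v (H_cls u v a) = evV u v a"
proof -
  have eq: "evV u v b = evV u v a" if b: "b \<in> fcar H_gens \<and> H_cls u v b = H_cls u v a" for b
  proof (rule alg_rep.ev_cls_eq[OF alg_rep_V H.presentation_axioms])
    show "pres_cls H_gens (H_rels u v) b = pres_cls H_gens (H_rels u v) a"
      using b by (simp add: H_cls_def)
  qed (use b assms evV_H_rel in blast)+
  show ?thesis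
    unfolding hact_def by (rule eq, rule someI[of _ a]) (use assms in blast)
qed

lemma hact_add: "h \<in> carrier (H_alg u v) \<Longrightarrow> h' \<in> carrier (H_alg u v) \<Longrightarrow>
    hact u v (h \<oplus>\<^bsub>H_alg u v\<^esub> h') = hact u v h + hact u v h'"
  and hact_mult: "h \<in> carrier (H_alg u v) \<Longrightarrow> h' \<in> carrier (H_alg u v) \<Longrightarrow>
    hact u v (h \<otimes>\<^bsub>H_alg u v\<^esub> h') = hact u v h * hact u v h'"
  and hact_one: "hact u v \<one>\<^bsub>H_alg u v\<^esub> = 1"
  by (auto simp: carrier_H H_cls_simps hact_cls evV_simps)

lemma hact_uminus: "h \<in> carrier (H_alg u v) \<Longrightarrow> hact u v (\<ominus>\<^bsub>H_alg u v\<^esub> h) = - hact u v h"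
  by (auto simp: carrier_H H.cls_uminus[unfolded presentation_folds] hact_cls evV_simps)

text \<open>Elements of the subalgebra keep constants constant, so the new vector is read off at
  exponent 0. The value \<open>undefined\<close> elsewhere is the one prescribed in
  \<open>extend_zero\<close>.\<close>

definition "zext u v h = (if h \<in> carrier (Hy_alg u v)
  then (\<lambda>m. Poly_Mapping.lookup (app (hact u v h) (Poly_Mapping.single 0 m)) 0) else undefined)"

lemma hact_const:
  assumes "h \<in> carrier (Hy_alg u v)"
  shows "app (hact u v h) (Poly_Mapping.single 0 m) = Poly_Mapping.single 0 (zext u v h m)"
proof -
  have "\<exists>m'. app (hact u v h) (Poly_Mapping.single 0 m) = Poly_Mapping.single 0 m'" for m
    using assms unfolding Hy_simps
  proof (induction arbitrary: m rule: generate_ring.induct)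
    case one
    show ?case by (auto simp: hact_one)
  next
    case (incl h)
    then show ?case
      by (auto simp: hact_cls subsetD[OF K_subset_H] evV_K yV_const evV_simps intro: exI[of _ 0])
  next
    case (a_inv h)
    then have "h \<in> carrier (H_alg u v)" by (auto intro: generated_in_H)
    with a_inv.IH[of m] show ?case by (auto simp: hact_uminus simp flip: single_uminus)
  next
    case (eng_add h1 h2)
    then have "h1 \<in> carrier (H_alg u v)" "h2 \<in> carrier (H_alg u v)" by (auto intro: generated_in_H)
    with eng_add.IH(1)[of m] eng_add.IH(2)[of m] show ?case by (auto simp: hact_add simp flip: single_add)
  next
    case (eng_mult h1 h2)
    then have "h1 \<in> carrier (H_alg u v)" "h2 \<in> carrier (H_alg u v)" by (auto intro: generated_in_H)
    moreover obtain m' where "app (hact u v h2) (Poly_Mapping.single 0 m) = Poly_Mapping.single 0 m'"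
      using eng_mult.IH(2) by blast
    ultimately show ?case using eng_mult.IH(1)[of m'] by (simp add: hact_mult)
  qed
  then obtain m' where "app (hact u v h) (Poly_Mapping.single 0 m) = Poly_Mapping.single 0 m'" by blast
  then show ?thesis using assms by (simp add: zext_def)
qed

lemma Hy_closed:
  "\<one>\<^bsub>H_alg u v\<^esub> \<in> carrier (Hy_alg u v)"
  "h \<in> carrier (Hy_alg u v) \<Longrightarrow> h' \<in> carrier (Hy_alg u v) \<Longrightarrow> h \<oplus>\<^bsub>H_alg u v\<^esub> h' \<in> carrier (Hy_alg u v)"
  "h \<in> carrier (Hy_alg u v) \<Longrightarrow> h' \<in> carrier (Hy_alg u v) \<Longrightarrow> h \<otimes>\<^bsub>H_alg u v\<^esub> h' \<in> carrier (Hy_alg u v)"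
  "a \<in> fcar K_gens \<Longrightarrow> H_cls u v a \<in> carrier (Hy_alg u v)"
  "H_cls u v (yg i) \<in> carrier (Hy_alg u v)"
  unfolding Hy_simps by (auto intro: generate_ring.intros)

lemma zext_eqI:
  assumes "h \<in> carrier (Hy_alg u v)"
    "app (hact u v h) (Poly_Mapping.single 0 m) = Poly_Mapping.single 0 m'"
  shows "zext u v h m = m'"
  using assms by (simp add: zext_def)

text \<open>Existence comes from restricting the action to constants, uniqueness from induction over
  the generated subring. The vector stays arbitrary there because h1 h2 applies h1 to the image of
  the vector under h2.\<close>

lemma extend_zero_eq: "extend_zero u v \<rho> = zext u v"
  unfolding extend_zero_def
proof (rule the_equality)
  have in_H: "h \<in> carrier (H_alg u v)" if "h \<in> carrier (Hy_alg u v)" for h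
    by (rule subsetD[OF Hy_subset that])
  have "left_module (Hy_alg u v) (zext u v)"
    unfolding left_module_def Hy_simps(1-3)
    by (intro conjI ballI allI zext_eqI Hy_closed;
        simp add: hact_one hact_const hact_add hact_mult in_H single_add)
  moreover have "zext u v (H_cls u v a) = \<rho> (K_cls a)" if "a \<in> fcar K_gens" for a
    using that by (intro ext zext_eqI Hy_closed) (auto simp: hact_cls subsetD[OF K_subset_H] evV_K)
  moreover have "zext u v (H_cls u v (yg i)) = (\<lambda>_. 0)" for i
    by (intro ext zext_eqI Hy_closed) (auto simp: hact_cls evV_simps yV_const)
  ultimately show "left_module (Hy_alg u v) (zext u v) \<and>
     (\<forall>a\<in>fcar K_gens. zext u v (H_cls u v a) = \<rho> (K_cls a)) \<and>
     (\<forall>i. zext u v (H_cls u v (yg i)) = (\<lambda>_. 0)) \<and>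
     (\<forall>h. h \<notin> carrier (Hy_alg u v) \<longrightarrow> zext u v h = undefined)"
    by (simp add: zext_def)
  then have Z: "left_module (Hy_alg u v) (zext u v)"
     "\<And>a. a\<in>fcar K_gens \<Longrightarrow> zext u v (H_cls u v a) = \<rho> (K_cls a)"
     "\<And>i. zext u v (H_cls u v (yg i)) = (\<lambda>_. 0)" by auto
  fix \<rho>'
  assume R: "left_module (Hy_alg u v) \<rho>' \<and>
     (\<forall>a\<in>fcar K_gens. \<rho>' (H_cls u v a) = \<rho> (K_cls a)) \<and>
     (\<forall>i. \<rho>' (H_cls u v (yg i)) = (\<lambda>_. 0)) \<and>
     (\<forall>h. h \<notin> carrier (Hy_alg u v) \<longrightarrow> \<rho>' h = undefined)"
  have "\<rho>' h m = zext u v h m" if "h \<in> carrier (Hy_alg u v)" for h m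
    using that[unfolded Hy_simps]
  proof (induction arbitrary: m rule: generate_ring.induct)
    case one
    show ?case using R Z by (simp add: left_module_def Hy_simps(1))
  next
    case (incl h)
    then show ?case using R Z by auto
  next
    case (a_inv h)
    then show ?case using R Z left_module_uminus by (metis Hy_simps(4))
  next
    case (eng_add h1 h2)
    then have "h1 \<in> carrier (Hy_alg u v)" "h2 \<in> carrier (Hy_alg u v)" by (auto simp: Hy_simps(4))
    then show ?case using R Z(1) eng_add.IH by (simp add: left_module_def Hy_simps(1-3))
  next
    case (eng_mult h1 h2)
    then have "h1 \<in> carrier (Hy_alg u v)" "h2 \<in> carrier (Hy_alg u v)" by (auto simp: Hy_simps(4))
    then show ?case using R Z(1) eng_mult.IH by (simp add: left_module_def Hy_simps(1-3))
  qed
  then show "\<rho>' = zext u v" using R by (intro ext) (metis zext_def)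
qed

end

section \<open>The induced module\<close>

lemma H_cls_mult_cong:
  "\<lbrakk>H_cls u v a = H_cls u v a'; H_cls u v b = H_cls u v b';
    a \<in> fcar H_gens; a' \<in> fcar H_gens; b \<in> fcar H_gens; b' \<in> fcar H_gens\<rbrakk>
    \<Longrightarrow> H_cls u v (a * b) = H_cls u v (a' * b')"
  by (metis H_cls_simps(3))

lemma H_cls_rel: "a - b \<in> H_rels u v \<Longrightarrow> a \<in> fcar H_gens \<Longrightarrow> b \<in> fcar H_gens \<Longrightarrow> H_cls u v a = H_cls u v b"
  using H.cls_rel by (simp add: H_cls_def)

lemma K_rels_subset: "K_rels \<subseteq> H_rels u v"
  unfolding H_rels_def by blast

lemma H_cls_xx: "H_cls u v (xg i * xg j) = H_cls u v (xg j * xg i)"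
proof (rule H_cls_rel)
  have "commutator (xg i) (xg j) \<in> H_rels u v" unfolding H_rels_def by blast
  then show "xg i * xg j - xg j * xg i \<in> H_rels u v" by (simp add: commutator_def)
qed auto

lemma H_cls_x_power: "H_cls u v (xg j * xg i ^ k) = H_cls u v (xg i ^ k * xg j)"
proof (induction k)
  case (Suc k)
  have "H_cls u v (xg j * xg i * xg i ^ k) = H_cls u v (xg i * xg j * xg i ^ k)"
    by (rule H_cls_mult_cong) (auto simp: H_cls_xx fcar_power)
  moreover have "H_cls u v (xg i * (xg j * xg i ^ k)) = H_cls u v (xg i * (xg i ^ k * xg j))"
    by (rule H_cls_mult_cong) (auto simp: Suc fcar_power)
  ultimately show ?case by (simp add: mult.assoc)
qed simp

lemma xmon_fcar [simp]: "xmon a \<in> fcar H_gens"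
  unfolding xmon_def by (auto intro!: fcar_prod_list fcar_power)

text \<open>The letter x_j commutes past the blocks of other variables until it reaches its own
  block.\<close>

lemma H_cls_x_xmon:
  fixes a :: "'n::{finite,linorder} \<Rightarrow>\<^sub>0 nat"
  shows "H_cls u v (xg j * xmon a) = H_cls u v (xmon (Poly_Mapping.single j 1 + a))"
proof -
  let ?p = "\<lambda>a l. prod_list (map (\<lambda>i. xg i ^ Poly_Mapping.lookup a i) l) :: 'n gen falg"
  let ?e = "Poly_Mapping.single j (1::nat)"
  have p: "?p a l \<in> fcar H_gens" for a l
    by (auto intro!: fcar_prod_list fcar_power)
  \<comment> \<open>Passing from the sorted list of all indices to any duplicate-free list
    containing \<open>j\<close> makes the induction possible.\<close>
  have "distinct l \<Longrightarrow> j \<in> set l \<Longrightarrow> H_cls u v (xg j * ?p a l) = H_cls u v (?p (?e + a) l)" for l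
  proof (induction l)
    case (Cons i l)
    show ?case
    proof (cases "i = j")
      case True
      with Cons.prems have "j \<notin> set l" by simp
      then have "map (\<lambda>i. xg i ^ Poly_Mapping.lookup (?e + a) i) l
          = (map (\<lambda>i. xg i ^ Poly_Mapping.lookup a i) l :: 'n gen falg list)"
        by (intro map_cong) (auto simp: lookup_add lookup_single when_def)
      then have l: "?p (?e + a) l = ?p a l" by (simp only:)
      have "?p (?e + a) (i # l) = xg j * xg j ^ Poly_Mapping.lookup a j * ?p a l"
        unfolding l[symmetric] using True by (simp add: lookup_add)
      then show ?thesis using True by (simp only:) (simp add: mult.assoc)
    next
      case False
      have "H_cls u v (xg j * xg i ^ Poly_Mapping.lookup a i * ?p a l)
          = H_cls u v (xg i ^ Poly_Mapping.lookup a i * xg j * ?p a l)"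
        by (rule H_cls_mult_cong) (simp_all add: H_cls_x_power fcar_power p)
      also have "\<dots> = H_cls u v (xg i ^ Poly_Mapping.lookup a i * (xg j * ?p a l))"
        by (simp add: mult.assoc)
      also have "\<dots> = H_cls u v (xg i ^ Poly_Mapping.lookup a i * ?p (?e + a) l)"
        using Cons False by (intro H_cls_mult_cong) (simp_all add: fcar_power p)
      finally show ?thesis using False
        by (simp add: mult.assoc lookup_add lookup_single when_def)
    qed
  qed simp
  from this[of "sorted_list_of_set UNIV"] show ?thesis by (simp add: xmon_def)
qed

lemma xmon_zero [simp]: "xmon 0 = 1"
proof -
  have "prod_list (map (\<lambda>_. 1) l) = (1 :: 'a gen falg)" for l :: "'a list"
    by (induction l) auto
  then show ?thesis by (simp add: xmon_def)
qed

context K_module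
begin

lemma evV_xmon: "app (evV u v (xmon a)) (Poly_Mapping.single b m) = Poly_Mapping.single (a + b) m"
proof -
  have pow: "app (evV u v (xg i ^ k)) (Poly_Mapping.single b m) = Poly_Mapping.single (Poly_Mapping.single i k + b) m"
    for i k b
  proof (induction k)
    case (Suc k)
    have "Poly_Mapping.single i (Suc k) = Poly_Mapping.single i 1 + Poly_Mapping.single i k"
      by (simp add: single_add[symmetric])
    then show ?case using Suc by (simp add: evV_simps xV_single add.assoc del: One_nat_def)
  qed (simp add: evV_simps)
  have "app (evV u v (prod_list (map (\<lambda>i. xg i ^ Poly_Mapping.lookup a i) l))) (Poly_Mapping.single b m)
      = Poly_Mapping.single ((\<Sum>i\<leftarrow>l. Poly_Mapping.single i (Poly_Mapping.lookup a i)) + b) m" for l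
    by (induction l) (simp_all add: evV_simps pow add.assoc)
  moreover have "(\<Sum>i\<leftarrow>sorted_list_of_set UNIV. Poly_Mapping.single i (Poly_Mapping.lookup a i)) = a"
  proof -
    have "(\<Sum>i\<leftarrow>sorted_list_of_set UNIV. Poly_Mapping.single i (Poly_Mapping.lookup a i))
        = (\<Sum>i\<in>UNIV. Poly_Mapping.single i (Poly_Mapping.lookup a i))"
      by (simp add: sum_list_distinct_conv_sum_set)
    also have "\<dots> = a"
      by (rule poly_mapping_eqI) (simp add: lookup_sum lookup_single when_def)
    finally show ?thesis .
  qed
  ultimately show ?thesis by (simp add: xmon_def)
qed

context
  fixes u v :: complex
begin

interpretation T: tensor_product "H_alg u v" "Hy_alg u v" "zext u v"
  by (rule tensor_product.intro[OF ring_H Hy_subset])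

notation T.teq (infix "\<asymp>" 50)

text \<open>A representative of the identification in the free abelian group. Pairs do not add in
  either entry there, so \<open>pure\<close> is additive only up to the congruence.\<close>

definition pure :: "(('n \<Rightarrow>\<^sub>0 nat) \<Rightarrow>\<^sub>0 'm) \<Rightarrow> ('n gen falg set \<times> 'm \<Rightarrow>\<^sub>0 int)" where
  "pure t = (\<Sum>a\<in>Poly_Mapping.keys t. frag_of (H_cls u v (xmon a), Poly_Mapping.lookup t a))"

definition lmul :: "'n gen falg \<Rightarrow> ('n gen falg set \<times> 'm \<Rightarrow>\<^sub>0 int) \<Rightarrow> ('n gen falg set \<times> 'm \<Rightarrow>\<^sub>0 int)" where
  "lmul b = pmul (H_alg u v) (H_cls u v b)"

lemma ind_ident_eq: "ind_ident u v \<rho> t = tensor_cls (H_alg u v) (Hy_alg u v) (zext u v) (pure t)"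
  by (simp add: ind_ident_def pure_def extend_zero_eq)

lemma pure_closed: "pure t \<in> carrier T.PG"
proof -
  have "(\<Sum>a\<in>A. frag_of (H_cls u v (xmon a), Poly_Mapping.lookup t a)) \<in> carrier T.PG" if "finite A" for A
    using that by (induction A rule: finite_induct) (auto intro!: T.PG_closed simp: H_cls_simps)
  then show ?thesis by (simp add: pure_def)
qed

text \<open>A pair with second entry 0 is a nonzero generator of the free abelian group but is
  congruent to 0, so terms outside the support may be added.\<close>

lemma pure_superset:
  assumes "finite A" "Poly_Mapping.keys t \<subseteq> A"
  shows "pure t \<asymp> (\<Sum>a\<in>A. frag_of (H_cls u v (xmon a), Poly_Mapping.lookup t a))"
proof -
  have "finite (A - Poly_Mapping.keys t)" using assms by simp
  moreover have "(\<Sum>a\<in>B. frag_of (H_cls u v (xmon a), Poly_Mapping.lookup t a)) \<asymp> 0"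
    if "finite B" "B \<inter> Poly_Mapping.keys t = {}" for B
    using that
  proof (induction B rule: finite_induct)
    case (insert a B)
    then have "frag_of (H_cls u v (xmon a), Poly_Mapping.lookup t a) \<asymp> 0"
      using T.frag_zero_right[of "H_cls u v (xmon a)"] by (simp add: in_keys_iff H_cls_simps)
    from T.teq_add[OF this insert.IH] insert show ?case by simp
  qed simp
  ultimately have "(\<Sum>a\<in>A - Poly_Mapping.keys t. frag_of (H_cls u v (xmon a), Poly_Mapping.lookup t a)) \<asymp> 0"
    by blast
  from T.teq_add[OF T.teq_refl[of "pure t"] T.teq_sym[OF this]] show ?thesis
    using sum.subset_diff[OF assms(2,1), of "\<lambda>a. frag_of (H_cls u v (xmon a), Poly_Mapping.lookup t a)"]
    by (simp add: pure_def add.commute)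
qed

lemma pure_single: "pure (Poly_Mapping.single a m) \<asymp> frag_of (H_cls u v (xmon a), m)"
  using pure_superset[of "{a}" "Poly_Mapping.single a m"] by (simp split: if_splits)

lemma pure_add: "pure (s + t) \<asymp> pure s + pure t"
proof -
  let ?A = "Poly_Mapping.keys s \<union> Poly_Mapping.keys t"
  let ?f = "\<lambda>s a. frag_of (H_cls u v (xmon a), Poly_Mapping.lookup s a)"
  have "sum (?f (s + t)) B \<asymp> sum (?f s) B + sum (?f t) B" if "finite B" for B
    using that
  proof (induction B rule: finite_induct)
    case (insert a B)
    have "?f (s + t) a \<asymp> ?f s a + ?f t a"
      using T.frag_add_right[of "H_cls u v (xmon a)"] by (simp add: lookup_add H_cls_simps)
    from T.teq_add[OF this insert.IH] insert show ?case by (simp add: add_ac)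
  qed simp
  then have "sum (?f (s + t)) ?A \<asymp> sum (?f s) ?A + sum (?f t) ?A" by simp
  moreover have "pure (s + t) \<asymp> sum (?f (s + t)) ?A"
    by (rule pure_superset) (auto simp: Poly_Mapping.keys_add)
  moreover have "sum (?f s) ?A + sum (?f t) ?A \<asymp> pure s + pure t"
    by (intro T.teq_add T.teq_sym[OF pure_superset]) auto
  ultimately show ?thesis by (blast intro: T.teq_trans)
qed

lemma pure_zero: "pure 0 = 0"
  by (simp add: pure_def)

text \<open>Evaluating the tensor product at the action on constants is a left inverse of the
  identification.\<close>

lemma inj_ind_ident: "inj (ind_ident u v \<rho>)"
proof (rule injI)
  fix s t :: "('n \<Rightarrow>\<^sub>0 nat) \<Rightarrow>\<^sub>0 'm"
  assume "ind_ident u v \<rho> s = ind_ident u v \<rho> t"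
  then have eq: "pure s \<asymp> pure t" by (simp add: ind_ident_eq T.tensor_cls_eq_iff)
  let ?f = "\<lambda>a m. app (hact u v a) (Poly_Mapping.single 0 m)"
  have f: "\<And>a b m. a \<in> carrier (H_alg u v) \<Longrightarrow> b \<in> carrier (H_alg u v) \<Longrightarrow>
      ?f (a \<oplus>\<^bsub>H_alg u v\<^esub> b) m = ?f a m + ?f b m"
    "\<And>a m m'. a \<in> carrier (H_alg u v) \<Longrightarrow> ?f a (m + m') = ?f a m + ?f a m'"
    "\<And>a s m. a \<in> carrier (H_alg u v) \<Longrightarrow> s \<in> carrier (Hy_alg u v) \<Longrightarrow>
      ?f (a \<otimes>\<^bsub>H_alg u v\<^esub> s) m = ?f a (zext u v s m)"
    by (simp_all add: hact_add hact_mult hact_const single_add subsetD[OF Hy_subset])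
  obtain \<psi> where
    \<psi>: "\<And>a m. a \<in> carrier (H_alg u v) \<Longrightarrow> \<psi> (frag_of (a, m)) = ?f a m"
      "\<And>z z'. z \<in> carrier T.PG \<Longrightarrow> z' \<in> carrier T.PG \<Longrightarrow> \<psi> (z + z') = \<psi> z + \<psi> z'"
      "\<And>z z'. z \<in> carrier T.PG \<Longrightarrow> z' \<in> carrier T.PG \<Longrightarrow> z \<asymp> z' \<Longrightarrow> \<psi> z = \<psi> z'"
    by (rule T.universal[of ?f], rule f(1), assumption+, rule f(2), assumption,
        rule f(3), assumption+, rule that)
  have zero: "\<psi> 0 = 0" using \<psi>(2)[of 0 0] T.PG_closed(4) by simp
  have "\<psi> (pure t) = t" for t
  proof -
    have "(\<Sum>a\<in>A. frag_of (H_cls u v (xmon a), Poly_Mapping.lookup t a)) \<in> carrier T.PG \<and>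
       \<psi> (\<Sum>a\<in>A. frag_of (H_cls u v (xmon a), Poly_Mapping.lookup t a))
        = (\<Sum>a\<in>A. Poly_Mapping.single a (Poly_Mapping.lookup t a))" if "finite A" for A
      using that
      by (induction A rule: finite_induct)
         (auto simp: zero \<psi>(1,2) T.PG_closed H_cls_simps hact_cls evV_xmon)
    from this[of "Poly_Mapping.keys t"] show ?thesis
      by (simp add: pure_def flip: poly_mapping_sum_single)
  qed
  then show "s = t" using \<psi>(3)[OF pure_closed pure_closed eq] by simp
qed

section \<open>Compatibility of the identification with the generators\<close>

definition intertwines :: "'n gen falg \<Rightarrow> bool" where
  "intertwines b \<longleftrightarrow> (\<forall>t. lmul b (pure t) \<asymp> pure (app (evV u v b) t))"

lemma lmul_cong: "b \<in> fcar H_gens \<Longrightarrow> z \<asymp> z' \<Longrightarrow> lmul b z \<asymp> lmul b z'"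
  unfolding lmul_def by (rule T.pmul_cong) (auto simp: H_cls_simps)

lemma lmul_add: "a \<in> fcar H_gens \<Longrightarrow> b \<in> fcar H_gens \<Longrightarrow> lmul (a + b) (pure t) \<asymp> lmul a (pure t) + lmul b (pure t)"
  using T.pmul_add[of "H_cls u v a" "H_cls u v b"] pure_closed by (simp add: lmul_def H_cls_simps)

lemma lmul_mult: "a \<in> fcar H_gens \<Longrightarrow> b \<in> fcar H_gens \<Longrightarrow> lmul (a * b) (pure t) = lmul a (lmul b (pure t))"
  using T.pmul_mult[of "H_cls u v a" "H_cls u v b"] pure_closed by (simp add: lmul_def H_cls_simps)

lemma intertwines_add:
  assumes "a \<in> fcar H_gens" "b \<in> fcar H_gens" "intertwines a" "intertwines b"
  shows "intertwines (a + b)"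
  unfolding intertwines_def
proof
  fix t
  have "lmul (a + b) (pure t) \<asymp> lmul a (pure t) + lmul b (pure t)" by (rule lmul_add) fact+
  also have "\<dots> \<asymp> pure (app (evV u v a) t) + pure (app (evV u v b) t)"
    using assms by (intro T.teq_add) (auto simp: intertwines_def)
  also have "\<dots> \<asymp> pure (app (evV u v (a + b)) t)"
    by (simp add: evV_simps T.teq_sym[OF pure_add])
  finally show "lmul (a + b) (pure t) \<asymp> pure (app (evV u v (a + b)) t)" .
qed

lemma intertwines_mult:
  assumes "a \<in> fcar H_gens" "b \<in> fcar H_gens" "intertwines a" "intertwines b"
  shows "intertwines (a * b)"
  unfolding intertwines_def
proof
  fix t
  have "lmul (a * b) (pure t) = lmul a (lmul b (pure t))" by (rule lmul_mult) fact+
  also have "\<dots> \<asymp> lmul a (pure (app (evV u v b) t))"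
    using assms by (intro lmul_cong) (auto simp: intertwines_def)
  also have "\<dots> \<asymp> pure (app (evV u v (a * b)) t)"
    using assms by (simp add: evV_simps intertwines_def)
  finally show "lmul (a * b) (pure t) \<asymp> pure (app (evV u v (a * b)) t)" .
qed

lemma intertwines_singleI:
  assumes b: "b \<in> fcar H_gens"
    and s: "\<And>a m. lmul b (pure (Poly_Mapping.single a m)) \<asymp> pure (app (evV u v b) (Poly_Mapping.single a m))"
  shows "intertwines b"
  unfolding intertwines_def
proof
  fix t
  show "lmul b (pure t) \<asymp> pure (app (evV u v b) t)"
  proof (induction t rule: update_induct)
    case const
    show ?case by (simp add: lmul_def pure_zero)
  next
    case (update t a m)
    have "Poly_Mapping.update a m t = t + Poly_Mapping.single a m"
      using update by (simp add: update_eq_add_single add.commute)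
    moreover have "lmul b (pure (t + Poly_Mapping.single a m)) \<asymp> lmul b (pure t + pure (Poly_Mapping.single a m))"
      by (rule lmul_cong[OF b pure_add])
    moreover have "lmul b (pure t + pure (Poly_Mapping.single a m))
        = lmul b (pure t) + lmul b (pure (Poly_Mapping.single a m))"
      by (simp add: lmul_def)
    moreover have "\<dots> \<asymp> pure (app (evV u v b) t) + pure (app (evV u v b) (Poly_Mapping.single a m))"
      by (intro T.teq_add update s)
    moreover have "\<dots> \<asymp> pure (app (evV u v b) (t + Poly_Mapping.single a m))"
      by (simp add: T.teq_sym[OF pure_add])
    ultimately show ?case by (auto intro: T.teq_trans)
  qed
qed

lemma intertwines_x: "intertwines (xg j)"
proof (rule intertwines_singleI)
  fix a and m :: 'm
  have "lmul (xg j) (pure (Poly_Mapping.single a m)) \<asymp> lmul (xg j) (frag_of (H_cls u v (xmon a), m))"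
    by (rule lmul_cong[OF _ pure_single]) simp
  also have "\<dots> = frag_of (H_cls u v (xmon (Poly_Mapping.single j 1 + a)), m)"
    by (simp only: lmul_def T.pmul_frag_of H_cls_x_xmon[symmetric])
       (simp add: H_cls_simps)
  also have "\<dots> \<asymp> pure (app (evV u v (xg j)) (Poly_Mapping.single a m))"
    using T.teq_sym[OF pure_single] by (simp add: evV_simps xV_single del: One_nat_def)
  finally show "lmul (xg j) (pure (Poly_Mapping.single a m)) \<asymp> pure (app (evV u v (xg j)) (Poly_Mapping.single a m))" .
qed simp

text \<open>An element of the subalgebra moves across the tensor sign: b \<otimes> m = 1 \<otimes> b
  m.\<close>

lemma lmul_const:
  assumes b: "b \<in> fcar H_gens" "H_cls u v b \<in> carrier (Hy_alg u v)"
  shows "lmul b (pure (Poly_Mapping.single 0 m)) \<asymp> pure (app (evV u v b) (Poly_Mapping.single 0 m))"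
proof -
  have "lmul b (pure (Poly_Mapping.single 0 m)) \<asymp> lmul b (frag_of (H_cls u v (xmon 0), m))"
    by (rule lmul_cong[OF b(1) pure_single])
  also have "\<dots> = frag_of (H_cls u v 1 \<otimes>\<^bsub>H_alg u v\<^esub> H_cls u v b, m)"
    using b by (simp add: lmul_def H_cls_simps)
  also have "\<dots> \<asymp> frag_of (H_cls u v 1, zext u v (H_cls u v b) m)"
    using b by (intro T.frag_balanced) (auto simp: H_cls_simps)
  also have "\<dots> \<asymp> pure (Poly_Mapping.single 0 (zext u v (H_cls u v b) m))"
    using T.teq_sym[OF pure_single[of 0]] by simp
  also have "\<dots> = pure (app (evV u v b) (Poly_Mapping.single 0 m))"
    using hact_const[OF b(2)] b(1) by (simp add: hact_cls)
  finally show ?thesis .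
qed

lemma evV_cong: "H_cls u v a = H_cls u v b \<Longrightarrow> a \<in> fcar H_gens \<Longrightarrow> b \<in> fcar H_gens \<Longrightarrow> evV u v a = evV u v b"
  using hact_cls by metis

text \<open>Induction on monomials by straightening: b x_k = d b + r pushes \<open>b\<close> towards
  the constants. The same equality of classes serves twice, in the tensor product and, through
  \<open>evV_cong\<close>, for the operators.\<close>

lemma intertwines_gen:
  assumes b: "b \<in> fcar H_gens" "H_cls u v b \<in> carrier (Hy_alg u v)"
    and comm: "\<And>k. \<exists>d r. d \<in> fcar H_gens \<and> r \<in> fcar H_gens \<and> intertwines d \<and> intertwines r \<and>
        H_cls u v (b * xg k) = H_cls u v (d * b + r)"
  shows "intertwines b"
proof (rule intertwines_singleI[OF b(1)])
  fix a and m :: 'm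
  show "lmul b (pure (Poly_Mapping.single a m)) \<asymp> pure (app (evV u v b) (Poly_Mapping.single a m))"
  proof (induction a rule: monomial_induct)
    case zero
    show ?case by (rule lmul_const[OF b])
  next
    case (step a k)
    obtain d r where d: "d \<in> fcar H_gens" "r \<in> fcar H_gens" "intertwines d" "intertwines r"
        "H_cls u v (b * xg k) = H_cls u v (d * b + r)"
      using comm by blast
    let ?s = "Poly_Mapping.single a m"
    have xs: "Poly_Mapping.single (Poly_Mapping.single k 1 + a) m = app (evV u v (xg k)) ?s"
      by (simp add: evV_simps xV_single del: One_nat_def)
    have "lmul b (pure (app (evV u v (xg k)) ?s)) \<asymp> lmul b (lmul (xg k) (pure ?s))"
      by (rule lmul_cong[OF b(1)], rule T.teq_sym, rule intertwines_x[unfolded intertwines_def, rule_format])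
    also have "\<dots> = lmul (b * xg k) (pure ?s)" by (rule lmul_mult[symmetric]) (use b in auto)
    also have "\<dots> = lmul (d * b + r) (pure ?s)" by (simp add: lmul_def d)
    also have "\<dots> \<asymp> lmul (d * b) (pure ?s) + lmul r (pure ?s)" by (rule lmul_add) (use b d in auto)
    also have "lmul (d * b) (pure ?s) = lmul d (lmul b (pure ?s))" by (rule lmul_mult) (use b d in auto)
    also have "lmul d (lmul b (pure ?s)) + lmul r (pure ?s)
        \<asymp> lmul d (pure (app (evV u v b) ?s)) + pure (app (evV u v r) ?s)"
      using d step by (intro T.teq_add lmul_cong) (auto simp: intertwines_def)
    also have "\<dots> \<asymp> pure (app (evV u v d) (app (evV u v b) ?s)) + pure (app (evV u v r) ?s)"
      using d by (intro T.teq_add) (auto simp: intertwines_def)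
    also have "\<dots> \<asymp> pure (app (evV u v d) (app (evV u v b) ?s) + app (evV u v r) ?s)"
      by (rule T.teq_sym[OF pure_add])
    also have "\<dots> = pure (app (evV u v (d * b + r)) ?s)" by (simp add: evV_simps)
    also have "evV u v (d * b + r) = evV u v (b * xg k)"
      using b d by (intro evV_cong) auto
    also have "pure (app (evV u v (b * xg k)) ?s) = pure (app (evV u v b) (app (evV u v (xg k)) ?s))"
      by (simp add: evV_simps)
    finally show ?case unfolding xs .
  qed
qed

lemma intertwines_scal: "intertwines (fscal z)"
proof (rule intertwines_gen)
  \<comment> \<open>By 0 + 0 = 0 this element is congruent to its double. Zero is treated before the
    scalars because it serves as their remainder \<open>r\<close>.\<close>
  have "lmul 0 (pure t) \<asymp> 0" for t
    using T.teq_minus[OF lmul_add[of 0 0 t]] by (simp add: T.teq_def)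
  then have zero: "intertwines 0" by (simp add: intertwines_def evV_simps pure_zero)
  show "\<exists>d r. d \<in> fcar H_gens \<and> r \<in> fcar H_gens \<and> intertwines d \<and> intertwines r \<and>
        H_cls u v (fscal z * xg k) = H_cls u v (d * fscal z + r)" for k
    by (rule exI[of _ "xg k"], rule exI[of _ 0]) (simp add: zero intertwines_x fscal_commute)
qed (auto intro: Hy_closed)

lemma intertwines_zero: "intertwines 0"
  using intertwines_scal[of 0] by simp

lemma intertwines_minus_x: "intertwines (- xg k)"
proof -
  have "- xg k = fscal (-1) * xg k" by (simp add: fscal_def single_uminus)
  then show ?thesis using intertwines_mult[OF _ _ intertwines_scal[of "-1"] intertwines_x[of k]] by simp
qed

lemma intertwines_c: "intertwines (cg j)"
proof (rule intertwines_gen)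
  fix k
  let ?d = "if j = k then - xg k else xg k"
  have "H_cls u v (cg j * xg k) = H_cls u v (?d * cg j)"
  proof (cases "j = k")
    case True
    have "xg k * cg k + cg k * xg k \<in> H_rels u v" unfolding H_rels_def by blast
    then have "cg k * xg k - (- xg k * cg k) \<in> H_rels u v" by (simp add: add.commute)
    with True show ?thesis using H_cls_rel[of "cg k * xg k" "- xg k * cg k"] by simp
  next
    case False
    then have "commutator (xg k) (cg j) \<in> H_rels u v" unfolding H_rels_def by blast
    then have "xg k * cg j - cg j * xg k \<in> H_rels u v" by (simp add: commutator_def)
    then show ?thesis using False H_cls_rel[of "xg k * cg j" "cg j * xg k"] by simp
  qed
  then show "\<exists>d r. d \<in> fcar H_gens \<and> r \<in> fcar H_gens \<and> intertwines d \<and> intertwines r \<and>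
        H_cls u v (cg j * xg k) = H_cls u v (d * cg j + r)"
    by (intro exI[of _ ?d] exI[of _ 0]) (simp add: intertwines_x intertwines_minus_x intertwines_zero)
qed (auto intro: Hy_closed)

text \<open>The relation conjugates x_k, so it is multiplied by \<open>w\<close> on the right and
  the product of the inverse with \<open>w\<close> is cancelled. The left factor \<open>d\<close>
  becomes the signed variable w(x_k).\<close>

lemma intertwines_w:
  assumes w: "w \<in> carrier B_group"
  shows "intertwines (wg w)"
proof (rule intertwines_gen)
  fix k
  let ?d = "signed_act w xg k" and ?i = "wg (inv\<^bsub>B_group\<^esub> w)"
  have d: "?d \<in> fcar H_gens" using w by (simp add: signed_act_fcar)
  have "H_cls u v (?i * wg w) = H_cls u v 1"
  proof -
    have "?i * wg w - wg (inv\<^bsub>B_group\<^esub> w \<otimes>\<^bsub>B_group\<^esub> w) \<in> H_rels u v"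
      using w by (intro subsetD[OF K_rels_subset]) (unfold K_rels_def, blast intro: B.inv_closed)
    then have "H_cls u v (?i * wg w) = H_cls u v (wg \<one>\<^bsub>B_group\<^esub>)"
      using w by (intro H_cls_rel) auto
    also have "wg \<one>\<^bsub>B_group\<^esub> - 1 \<in> H_rels u v"
      by (intro subsetD[OF K_rels_subset]) (unfold K_rels_def, blast)
    then have "H_cls u v (wg \<one>\<^bsub>B_group\<^esub>) = H_cls u v 1" by (intro H_cls_rel) auto
    finally show ?thesis .
  qed
  then have "H_cls u v (wg w * xg k * (?i * wg w)) = H_cls u v (wg w * xg k * 1)"
    using w by (intro H_cls_mult_cong) auto
  moreover have "H_cls u v (wg w * xg k * ?i * wg w) = H_cls u v (?d * wg w)"
  proof (rule H_cls_mult_cong)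
    have "wg w * xg k * ?i - ?d \<in> H_rels u v" using w unfolding H_rels_def by blast
    then show "H_cls u v (wg w * xg k * ?i) = H_cls u v ?d"
      using w d by (intro H_cls_rel) auto
  qed (use w d in auto)
  ultimately have "H_cls u v (wg w * xg k) = H_cls u v (?d * wg w)" by (simp add: mult.assoc)
  moreover have "intertwines ?d"
    using sign_cases[OF w, of k] by (auto simp: signed_act_def intertwines_x intertwines_minus_x)
  ultimately show "\<exists>d r. d \<in> fcar H_gens \<and> r \<in> fcar H_gens \<and> intertwines d \<and> intertwines r \<and>
        H_cls u v (wg w * xg k) = H_cls u v (d * wg w + r)"
    using d by (intro exI[of _ ?d] exI[of _ 0]) (simp add: intertwines_zero)
qed (use w in \<open>auto intro: Hy_closed\<close>)

lemma intertwines_K: "a \<in> fcar K_gens \<Longrightarrow> intertwines a"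
proof (induction rule: fcar_induct)
  case (gen g)
  then show ?case by (cases g) (auto simp: intertwines_c intertwines_w)
qed (auto intro: intertwines_scal intertwines_add intertwines_mult subsetD[OF K_subset_H])

text \<open>Here the remainder \<open>r\<close> is the commutator. It lies in \<open>K\<close>,
  whose elements must therefore be treated before y_i.\<close>

lemma intertwines_y: "intertwines (yg i)"
proof (rule intertwines_gen)
  fix k
  obtain r where r: "r \<in> fcar K_gens" "commutator (yg i) (xg k) - r \<in> H_rels u v"
  proof (cases "i = k")
    case True
    show ?thesis
    proof (rule that)
      show "commutator (yg i) (xg k) - (- fscal u * (\<Sum>l\<in>UNIV - {i}. (1 + cg l * cg i) * wg (s_refl l i)
              + (1 - cg l * cg i) * wg (sbar_refl l i)) - fscal (of_real (sqrt 2) * v) * wg (tau_refl i)) \<in> H_rels u v"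
        unfolding H_rels_def True by blast
    qed (intro fcar_diff fcar_mult fcar_sum fcar_add; simp)
  next
    case False
    show ?thesis
    proof (rule that)
      show "commutator (yg i) (xg k) - fscal u * ((1 + cg i * cg k) * wg (s_refl k i)
          - (1 - cg i * cg k) * wg (sbar_refl k i)) \<in> H_rels u v"
        using False unfolding H_rels_def by blast
    qed (intro fcar_diff fcar_mult fcar_sum fcar_add; simp)
  qed
  have rH: "r \<in> fcar H_gens" by (rule subsetD[OF K_subset_H r(1)])
  have "yg i * xg k - (xg k * yg i + r) \<in> H_rels u v"
    using r(2) by (simp add: commutator_def diff_diff_eq)
  then have "H_cls u v (yg i * xg k) = H_cls u v (xg k * yg i + r)"
    using rH by (intro H_cls_rel) auto
  then show "\<exists>d r. d \<in> fcar H_gens \<and> r \<in> fcar H_gens \<and> intertwines d \<and> intertwines r \<and>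
        H_cls u v (yg i * xg k) = H_cls u v (d * yg i + r)"
    using rH intertwines_K[OF r(1)] by (intro exI[of _ "xg k"] exI[of _ r]) (simp add: intertwines_x)
qed (auto intro: Hy_closed)

text \<open>The image of \<open>ind_ident u v \<rho> t\<close> under the class of y_i again lies in
  the range of the identification, so injectivity lets \<open>inv_into\<close> recover the
  vector.\<close>

lemma ind_act_y: "ind_act u v \<rho> (H_cls u v (yg i)) t = app (yV u v i) t"
proof -
  have "tensor_act (H_alg u v) (Hy_alg u v) (zext u v) (H_cls u v (yg i)) (ind_ident u v \<rho> t)
      = ind_ident u v \<rho> (app (yV u v i) t)"
    using intertwines_y[of i]
    by (simp add: ind_ident_eq T.tensor_act_cls H_cls_simps T.tensor_cls_eq_iff intertwines_def lmul_def evV_simps)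
  then show ?thesis
    by (simp add: ind_act_def extend_zero_eq inv_into_f_f[OF inj_ind_ident])
qed

end

section \<open>Reading off the formula\<close>

lemma pscale_eq: "pscale \<rho> z t = app (sV z) t"
proof -
  have l: "Poly_Mapping.lookup (pscale \<rho> z t) a = app (sM z) (Poly_Mapping.lookup t a)" for t a
    by (simp add: pscale_def Poly_Mapping.map.rep_eq sM_def app_kM[symmetric] when_def)
  show ?thesis
  proof (rule additive_poly_mapping_eqI[of "pscale \<rho> z"])
    show "pscale \<rho> z (Poly_Mapping.single a m) = app (sV z) (Poly_Mapping.single a m)" for a m
      by (rule poly_mapping_eqI) (auto simp: l sV_def tens_single ptensor_single lookup_single when_def)
  qed (auto intro!: poly_mapping_eqI simp: l lookup_add)
qed

text \<open>Throughout the sums \<open>k\<close> differs from \<open>i\<close>, so the denominators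
  are nonzero and the divided differences are the exact quotients of the formula.\<close>

lemma yV_ptensor:
  "app (yV u v i) (ptensor \<rho> f m) =
    - pscale \<rho> u (\<Sum>k\<in>UNIV - {i}.
          ptensor \<rho> (pquot (f - poly_act (s_refl k i) f) (pvar i - pvar k))
            (\<rho> (K_cls (wg (s_refl k i))) m)
        + ptensor \<rho> (pquot (f - poly_act (sbar_refl k i) f) (pvar i + pvar k))
            (\<rho> (K_cls (cg k * cg i)) (\<rho> (K_cls (wg (s_refl k i))) m)))
    - pscale \<rho> u (\<Sum>k\<in>UNIV - {i}.
          ptensor \<rho> (pquot (f - poly_act (sbar_refl k i) f) (pvar i + pvar k))
            (\<rho> (K_cls (wg (sbar_refl k i))) m)
        - ptensor \<rho> (pquot (f - poly_act (s_refl k i) f) (pvar i - pvar k))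
            (\<rho> (K_cls (cg k * cg i)) (\<rho> (K_cls (wg (sbar_refl k i))) m)))
    - pscale \<rho> (of_real (sqrt 2) * v)
        (ptensor \<rho> (pquot (f - poly_act (tau_refl i) f) (2 * pvar i))
          (\<rho> (K_cls (wg (tau_refl i))) m))"
proof -
  have w: "app (wM w) m = \<rho> (K_cls (wg w)) m" if "w \<in> carrier B_group" for w m
    using that by (simp add: wM_def app_kM)
  have c: "app (cM k) (app (cM i) m) = \<rho> (K_cls (cg k * cg i)) m" for k m
    by (simp add: app_kM[symmetric] kM_mult cM_def)
  have D: "app (tens (Ds i k) L) (ptensor \<rho> f m) =
      ptensor \<rho> (pquot (f - poly_act (s_refl k i) f) (pvar i - pvar k)) (app L m)"
    "app (tens (Db i k) L) (ptensor \<rho> f m) =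
      ptensor \<rho> (pquot (f - poly_act (sbar_refl k i) f) (pvar i + pvar k)) (app L m)"
    if "k \<in> UNIV - {i}" "linM L" for k L
    using that skew_pairs[of i k] by (auto simp: tens_ptensor linP_dP app_dP ddiff_def)
  have Dt: "app (tens (Dt i) L) (ptensor \<rho> f m) =
      ptensor \<rho> (pquot (f - poly_act (tau_refl i) f) (2 * pvar i)) (app L m)" if "linM L" for L
    using that skew_pair_tau[of i] by (simp add: tens_ptensor linP_dP app_dP ddiff_def)
  have sums:
    "app (\<Sum>k\<in>UNIV - {i}. tens (Ds i k) (wM (s_refl k i)) + tens (Db i k) (cM k * cM i * wM (s_refl k i))) (ptensor \<rho> f m)
    = (\<Sum>k\<in>UNIV - {i}.
          ptensor \<rho> (pquot (f - poly_act (s_refl k i) f) (pvar i - pvar k))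
            (\<rho> (K_cls (wg (s_refl k i))) m)
        + ptensor \<rho> (pquot (f - poly_act (sbar_refl k i) f) (pvar i + pvar k))
            (\<rho> (K_cls (cg k * cg i)) (\<rho> (K_cls (wg (s_refl k i))) m)))"
    "app (\<Sum>k\<in>UNIV - {i}. tens (Db i k) (wM (sbar_refl k i)) - tens (Ds i k) (cM k * cM i * wM (sbar_refl k i))) (ptensor \<rho> f m)
    = (\<Sum>k\<in>UNIV - {i}.
          ptensor \<rho> (pquot (f - poly_act (sbar_refl k i) f) (pvar i + pvar k))
            (\<rho> (K_cls (wg (sbar_refl k i))) m)
        - ptensor \<rho> (pquot (f - poly_act (s_refl k i) f) (pvar i - pvar k))
            (\<rho> (K_cls (cg k * cg i)) (\<rho> (K_cls (wg (sbar_refl k i))) m)))"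
    unfolding app_sum_endo by (rule sum.cong, rule refl, simp add: D w c)+
  show ?thesis
    unfolding yV_def pscale_eq endo_apps sums by (simp add: Dt w)
qed

end

theorem theorem4p10:
  fixes u v :: complex
    and \<rho> :: "'n::{finite,linorder} gen falg set \<Rightarrow> 'm::ab_group_add \<Rightarrow> 'm"
    and f :: "'n cpoly" and m :: 'm and i :: 'n
  assumes "CARD('n) \<ge> 2"
    and "left_module K_alg \<rho>"
  shows "ind_act u v \<rho> (H_cls u v (yg i)) (ptensor \<rho> f m) =
    - pscale \<rho> u (\<Sum>k\<in>UNIV - {i}.
          ptensor \<rho> (pquot (f - poly_act (s_refl k i) f) (pvar i - pvar k))
            (\<rho> (K_cls (wg (s_refl k i))) m)
        + ptensor \<rho> (pquot (f - poly_act (sbar_refl k i) f) (pvar i + pvar k))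
            (\<rho> (K_cls (cg k * cg i)) (\<rho> (K_cls (wg (s_refl k i))) m)))
    - pscale \<rho> u (\<Sum>k\<in>UNIV - {i}.
          ptensor \<rho> (pquot (f - poly_act (sbar_refl k i) f) (pvar i + pvar k))
            (\<rho> (K_cls (wg (sbar_refl k i))) m)
        - ptensor \<rho> (pquot (f - poly_act (s_refl k i) f) (pvar i - pvar k))
            (\<rho> (K_cls (cg k * cg i)) (\<rho> (K_cls (wg (sbar_refl k i))) m)))
    - pscale \<rho> (of_real (sqrt 2) * v)
        (ptensor \<rho> (pquot (f - poly_act (tau_refl i) f) (2 * pvar i))
          (\<rho> (K_cls (wg (tau_refl i))) m))"
proof -
  interpret K_module \<rho> by standard fact
  show ?thesis by (simp only: ind_act_y yV_ptensor)
qed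

end
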